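(* Let $n\ge 1$, $\gamma\in(0,1)$, $T>0$, $\tau>0$, $s>0$, $\theta>1$, and let $p>0$ satisfy $p+2\le s$. Let $l\in[0,p+2]$ be such that $p+2-l\le s$. Then there exists a constant $C>0$, independent of $\delta$, $E$ and $t$, such that the following holds for all $\delta>0$ and $E>0$. Let $u$ be the solution of the final value problem $\partial_t^\gamma u=\Delta u$ on $\mathbb{R}^n\times(0,T)$, $u(\cdot,T)=g$, with $u(\cdot,0)\in H^p(\mathbb{R}^n)$ and $\|u(\cdot,0)\|_{H^p}\le E$. Let $g^\delta\in L^2(\mathbb{R}^n)$ satisfy $\|g-g^\delta\|_{L^2}\le\delta$ and $0<\theta\delta<\|g^\delta\|_{L^2}$, let $u_\alpha^\delta$ be the regularized solution associated with $g^\delta$ and $\alpha>0$, and let $\alpha(\delta,g^\delta)>0$ be the parameter satisfying $$\Big\|\big(1-e^{-\tau(\alpha(\delta,g^\delta)|\xi|)^s}\big)\widehat{g^\delta}(\xi)\Big\|_{L^2}=\theta\delta .$$ Then $$\forall t\in(0,T],\qquad \big\|u(\cdot,t)-u_{\alpha(\delta,g^\delta)}^\delta(\cdot,t)\big\|_{H^l}\le\frac{C}{t^\gamma}\,E^{\frac{l}{p+2}}\,\delta^{1-\frac{l}{p+2}}.$$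
   Context: The Fourier transform is $\widehat f(\xi)=(2\pi)^{-n/2}\int_{\mathbb{R}^n}f(x)e^{-ix\cdot\xi}\,dx$, and $\|f\|_{H^p}=\|(1+|\xi|^2)^{p/2}\widehat f\|_{L^2}$. $\partial_t^\gamma$ is the Caputo derivative $\partial_t^\gamma u(t)=\frac{1}{\Gamma(1-\gamma)}\int_0^t\frac{u'(r)}{(t-r)^\gamma}\,dr$. $E_{\gamma,1}(z)=\sum_{k\ge0}\frac{z^k}{\Gamma(\gamma k+1)}$ is the Mittag-Leffler function. A solution of $\partial_t^\gamma u=\Delta u$ is understood through its frequency representation $\widehat u(\xi,t)=\widehat u(\xi,0)\,E_{\gamma,1}(-|\xi|^2t^\gamma)$, $t\in[0,T]$ (transform in $x$); thus $\widehat g(\xi)=\widehat u(\xi,0)E_{\gamma,1}(-|\xi|^2T^\gamma)$ for $g=u(\cdot,T)$. The regularized solution $u_\alpha^\delta$ is defined by $$\widehat{u_\alpha^\delta}(\xi,t)=\frac{E_{\gamma,1}(-|\xi|^2t^\gamma)}{E_{\gamma,1}(-|\xi|^2T^\gamma)}\,e^{-\tau(\alpha|\xi|)^s}\,\widehat{g^\delta}(\xi),\qquad t\in[0,T].$$ Under the condition $0<\theta\delta<\|g^\delta\|_{L^2}$ the equation for $\alpha(\delta,g^\delta)$ has a unique solution. Here $E>0$ (a bound on the Sobolev norm) is not to be confused with the function $E_{\gamma,1}$. *)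

theory Defs
  imports "HOL-Analysis.Analysis"
begin

(* Elements of L2 are functions, not classes, so identities between L2 functions
   are stated almost everywhere. *)
definition L2 :: "(real ^ 'n \<Rightarrow> complex) set" where
  "L2 = {f. f \<in> borel_measurable lebesgue \<and> integrable lebesgue (\<lambda>x. (cmod (f x))\<^sup>2)}"

(* Meaningful on L2 only: the Bochner integral of a non-integrable function is 0. *)
definition L2_norm :: "(real ^ 'n \<Rightarrow> complex) \<Rightarrow> real" where
  "L2_norm f = sqrt (LINT x|lebesgue. (cmod (f x))\<^sup>2)"

definition fourier_integral :: "(real ^ 'n \<Rightarrow> complex) \<Rightarrow> real ^ 'n \<Rightarrow> complex" where
  "fourier_integral f \<xi> =
     of_real ((2 * pi) powr (- real CARD('n) / 2)) *
     (LINT x|lebesgue. f x * exp (- \<i> * of_real (x \<bullet> \<xi>)))"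

(* The Fourier integral of f in L2 need not converge; as usual, the transform is the
   L2 limit of the Fourier integrals of the truncations of f to balls. The limit is
   unique up to null sets. The error is measured by a nonnegative integral, so that
   an infinite error cannot pass for 0. *)
definition fourier :: "(real ^ 'n \<Rightarrow> complex) \<Rightarrow> real ^ 'n \<Rightarrow> complex" where
  "fourier f = (SOME F. F \<in> L2 \<and>
     ((\<lambda>R. \<integral>\<^sup>+ \<xi>. ennreal ((cmod (fourier_integral (\<lambda>x. indicator (cball 0 R) x * f x) \<xi> - F \<xi>))\<^sup>2)
              \<partial>lebesgue) \<longlongrightarrow> 0) at_top)"

definition sobolev_weight :: "real \<Rightarrow> (real ^ 'n \<Rightarrow> complex) \<Rightarrow> real ^ 'n \<Rightarrow> complex" where
  "sobolev_weight p F \<xi> = of_real ((1 + (norm \<xi>)\<^sup>2) powr (p / 2)) * F \<xi>"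

(* The space H^p for p \<ge> 0 only (for p < 0 it is not contained in L2). *)
definition sobolev_space :: "real \<Rightarrow> (real ^ 'n \<Rightarrow> complex) set" where
  "sobolev_space p = {f \<in> L2. sobolev_weight p (fourier f) \<in> L2}"

definition sobolev_norm :: "real \<Rightarrow> (real ^ 'n \<Rightarrow> complex) \<Rightarrow> real" where
  "sobolev_norm p f = L2_norm (sobolev_weight p (fourier f))"

definition mittag_leffler :: "real \<Rightarrow> real \<Rightarrow> real \<Rightarrow> real" where
  "mittag_leffler a b z = (\<Sum>k. z ^ k / Gamma (a * real k + b))"

(* The factor E_{\<gamma>,1}(-|\<xi>|^2 t^\<gamma>) by which the equation propagates the frequency \<xi>. *)
definition propagator :: "real \<Rightarrow> real \<Rightarrow> real ^ 'n \<Rightarrow> real" where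
  "propagator \<gamma> t \<xi> = mittag_leffler \<gamma> 1 (- ((norm \<xi>)\<^sup>2 * t powr \<gamma>))"

(* u solves the time-fractional diffusion equation (Caputo derivative of order \<gamma>
   in time, Laplacian in space) on [0,T], in the sense of the frequency
   representation; u t is the function u(.,t). *)
definition diffusion_solution :: "real \<Rightarrow> real \<Rightarrow> (real \<Rightarrow> real ^ 'n \<Rightarrow> complex) \<Rightarrow> bool" where
  "diffusion_solution \<gamma> T u \<longleftrightarrow>
     (\<forall>t\<in>{0..T}. u t \<in> L2 \<and>
        (AE \<xi> in lebesgue. fourier (u t) \<xi> = fourier (u 0) \<xi> * of_real (propagator \<gamma> t \<xi>)))"

definition final_value_solution ::
  "real \<Rightarrow> real \<Rightarrow> (real ^ 'n \<Rightarrow> complex) \<Rightarrow> (real \<Rightarrow> real ^ 'n \<Rightarrow> complex) \<Rightarrow> bool" where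
  "final_value_solution \<gamma> T g u \<longleftrightarrow>
     g \<in> L2 \<and> diffusion_solution \<gamma> T u \<and> (AE x in lebesgue. u T x = g x)"

definition regularizing_filter :: "real \<Rightarrow> real \<Rightarrow> real \<Rightarrow> real ^ 'n \<Rightarrow> real" where
  "regularizing_filter \<tau> s \<alpha> \<xi> = exp (- \<tau> * (\<alpha> * norm \<xi>) powr s)"

definition regularized_solution ::
  "real \<Rightarrow> real \<Rightarrow> real \<Rightarrow> real \<Rightarrow> real \<Rightarrow> (real ^ 'n \<Rightarrow> complex) \<Rightarrow>
   (real \<Rightarrow> real ^ 'n \<Rightarrow> complex) \<Rightarrow> bool" where
  "regularized_solution \<gamma> T \<tau> s \<alpha> h v \<longleftrightarrow>
     (\<forall>t\<in>{0..T}. v t \<in> L2 \<and>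
        (AE \<xi> in lebesgue. fourier (v t) \<xi> =
           of_real (propagator \<gamma> t \<xi> / propagator \<gamma> T \<xi> * regularizing_filter \<tau> s \<alpha> \<xi>) * fourier h \<xi>))"

end

theory Submission
  imports Defs "HOL-Real_Asymp.Real_Asymp" "HOL-Probability.Characteristic_Functions"
begin

text \<open>
  Write \<open>G\<close>, \<open>H\<close> for the transforms of \<open>g\<close>, \<open>g\<delta>\<close> and \<open>A\<close> for the filter. The transform of the error at time
  \<open>t\<close> is \<open>E\<^sub>t / E\<^sub>T * (G - A H)\<close>. Since \<open>E\<^sub>\<gamma>(- x)\<close> is comparable to \<open>1 / (1 + x)\<close>, the quotient is at most a multiple of
  \<open>t powr - \<gamma>\<close>, and \<open>G\<close> has a weighted norm of order \<open>p + 2\<close> bounded by a multiple of \<open>E\<close>. By the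
  discrepancy principle, \<open>G - A H\<close> has norm at most \<open>(1 + \<theta>) \<delta>\<close>, and the lower bound which the principle
  gives for \<open>\<alpha>\<close> keeps its weighted norm of order \<open>p + 2\<close> of order \<open>E\<close>; interpolation yields the rate.

  The bounds for \<open>E\<^sub>\<gamma>\<close> are obtained as limits of bounds for an implicit difference scheme, whose generating
  function is a quotient of powers of \<open>1 - z\<close>; positivity and monotonicity of the scheme follow from the signs of
  binomial coefficients. Plancherel's inequality comes from a Gaussian cut-off in frequency.
\<close>

text \<open>The alternating series of \<open>E\<^sub>\<gamma>(- x)\<close> shows neither its sign
  nor its decay, because large terms cancel. The difference scheme turns both into algebra: for
  \<gamma> in (0,1) the series of \<open>(1 - z)\<^sup>\<gamma>\<close> has a single positive
  coefficient, the constant one, so division by \<open>(1 - z)\<^sup>\<gamma> + \<mu>\<close>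
  preserves nonnegativity of coefficients. Hence the discrete solution is nonnegative and
  decreasing, and the two bounds follow from these facts. The order \<open>p + 2\<close> reflects
  that \<open>E\<^sub>T\<close> decays like the inverse square of the frequency: the final value is
  two orders smoother than the initial value, while the noise is not smooth at all.
  \<open>fourier\<close> is a choice among possible limits, so nothing is known about its value
  until some limit is shown to exist. Existence rests on completeness of \<open>L2\<close> together
  with Plancherel's inequality for truncations. The same inequality later carries the data error
  into frequency space, where the Sobolev norms are already defined.\<close>

section \<open>Two-sided bounds for the Mittag-Leffler function\<close>

unbundle no vec_syntax
unbundle fps_syntax

text \<open>The binomial series of \<open>(1 - z) powr (- a)\<close>. Multiplication adds exponents,
  so \<open>a = 1\<close> acts as summation, \<open>a = -1\<close> as the backward difference and
  \<open>a = - \<gamma>\<close> as a discrete fractional derivative.\<close>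

definition rising_fps :: "real \<Rightarrow> real fps" where
  "rising_fps a = Abs_fps (\<lambda>n. pochhammer a n / fact n)"

lemma rising_fps_nth: "rising_fps a $ n = pochhammer a n / fact n"
  by (simp add: rising_fps_def)

lemma rising_fps_0: "rising_fps 0 = 1"
  by (rule fps_ext) (simp add: rising_fps_nth pochhammer_0_left)

lemma rising_fps_1_nth: "rising_fps 1 $ n = 1"
  by (simp add: rising_fps_nth pochhammer_fact [symmetric])

text \<open>Coefficientwise this is Vandermonde's identity for rising factorials.\<close>

lemma rising_fps_mult: "rising_fps a * rising_fps b = rising_fps (a + b)"
proof (rule fps_ext)
  fix n
  have "(\<Sum>i\<le>n. pochhammer a i / fact i * (pochhammer b (n - i) / fact (n - i)))
      = (\<Sum>i\<le>n. real (n choose i) * pochhammer a i * pochhammer b (n - i) / fact n)"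
    by (rule sum.cong) (auto simp: binomial_fact field_simps)
  then show "(rising_fps a * rising_fps b) $ n = rising_fps (a + b) $ n"
    by (simp add: fps_mult_nth rising_fps_nth pochhammer_binomial_sum atLeast0AtMost sum_divide_distrib)
qed

lemma rising_fps_minus_1: "rising_fps (-1) = 1 - fps_X"
proof -
  have "rising_fps 1 * rising_fps (-1) = 1"
    by (simp add: rising_fps_mult rising_fps_0)
  moreover have "rising_fps 1 * (1 - fps_X) = 1"
    by (rule fps_ext) (simp add: right_diff_distrib rising_fps_1_nth)
  moreover have "rising_fps 1 \<noteq> 0"
    by (metis fps_zero_nth rising_fps_1_nth zero_neq_one)
  ultimately show ?thesis
    by (metis mult_left_cancel)
qed

lemma rising_fps_nonneg: "0 \<le> a \<Longrightarrow> 0 \<le> rising_fps a $ n"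
  by (simp add: rising_fps_nth pochhammer_nonneg pochhammer_prod prod_nonneg)

text \<open>The first factor of \<open>pochhammer (- a) n\<close> is \<open>- a\<close>; the
  remaining ones, \<open>1 - a\<close>, \<open>2 - a\<close> and so on, are nonnegative. This sign
  pattern gives the scheme its maximum principle.\<close>

lemma rising_fps_minus_nonpos:
  assumes "0 \<le> a" "a \<le> 1" "0 < n"
  shows "rising_fps (- a) $ n \<le> 0"
proof -
  obtain m where "n = Suc m" using \<open>0 < n\<close> by (cases n) auto
  moreover have "0 \<le> pochhammer (1 - a) m"
    using assms by (simp add: pochhammer_prod prod_nonneg)
  ultimately show ?thesis
    using \<open>0 \<le> a\<close>
    by (simp add: rising_fps_nth pochhammer_rec divide_nonpos_pos mult_nonneg_nonneg)
qed

lemma rising_fps_antimono: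
  assumes "0 \<le> a" "a \<le> 1" "m \<le> n"
  shows "rising_fps a $ n \<le> rising_fps a $ m"
proof -
  have "rising_fps a $ Suc k \<le> rising_fps a $ k" for k
  proof -
    have "rising_fps a $ Suc k = rising_fps a $ k * ((a + k) / (1 + k))"
      by (simp add: rising_fps_nth pochhammer_rec' field_simps)
    also have "\<dots> \<le> rising_fps a $ k * 1"
      using assms by (intro mult_left_mono rising_fps_nonneg) auto
    finally show ?thesis by simp
  qed
  then show ?thesis
    using \<open>m \<le> n\<close> by (rule lift_Suc_antimono_le[of "\<lambda>k. rising_fps a $ k"])
qed

text \<open>The limit formula for the reciprocal Gamma function. The rising factorial in
  \<open>rGamma_series a n\<close> has \<open>n + 1\<close> factors;
  \<open>real n / (a + real n)\<close> removes the last one, supplies a power of \<open>n\<close>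
  and tends to \<open>1\<close>.\<close>

lemma rising_fps_asymp:
  assumes "0 < a"
  shows "(\<lambda>n. rising_fps a $ n * real n powr (1 - a)) \<longlonglongrightarrow> 1 / Gamma a"
proof -
  have "(\<lambda>n. rGamma_series a n * (real n / (a + real n))) \<longlonglongrightarrow> rGamma a * 1"
  proof (intro tendsto_mult rGamma_series_LIMSEQ)
    show "(\<lambda>n. real n / (a + real n)) \<longlonglongrightarrow> 1" by real_asymp
  qed
  moreover have "\<forall>\<^sub>F n in sequentially. rGamma_series a n * (real n / (a + real n)) = rising_fps a $ n * real n powr (1 - a)"
  proof (rule eventually_mono[OF eventually_gt_at_top[of 0]])
    fix n :: nat assume "0 < n"
    have "rGamma_series a n * (real n / (a + real n)) = pochhammer a n / fact n * (real n / exp (a * ln (real n)))"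
      using assms \<open>0 < n\<close> by (simp add: rGamma_series_def pochhammer_rec')
    also have "real n / exp (a * ln (real n)) = real n powr (1 - a)"
      using \<open>0 < n\<close> by (simp add: powr_diff) (simp add: powr_def)
    finally show "rGamma_series a n * (real n / (a + real n)) = rising_fps a $ n * real n powr (1 - a)"
      by (simp add: rising_fps_nth)
  qed
  ultimately have "(\<lambda>n. rising_fps a $ n * real n powr (1 - a)) \<longlonglongrightarrow> rGamma a * 1"
    by (rule Lim_transform_eventually)
  then show ?thesis
    by (simp add: rGamma_inverse_Gamma inverse_eq_divide)
qed

text \<open>The coefficient is the product of \<open>1 + a / k\<close> over
  \<open>k = 1, ..., n\<close>. The first \<open>J\<close> factors are at most \<open>1 + a\<close>,
  each later one is at most \<open>(k / (k - 1)) powr a\<close>, and these bounds telescope. The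
  free parameter \<open>J\<close> serves to dominate a series in which \<open>a\<close> grows with
  the summation index.\<close>

lemma rising_fps_le:
  assumes "0 \<le> a" "0 < J" "J \<le> n"
  shows "rising_fps (a + 1) $ n \<le> (1 + a) ^ J * (real n / real J) powr a"
proof -
  have *: "rising_fps (a + 1) $ Suc k = rising_fps (a + 1) $ k * (1 + a / real (Suc k))" for k
    by (simp add: rising_fps_nth pochhammer_rec' field_simps)
  have init: "rising_fps (a + 1) $ k \<le> (1 + a) ^ k" for k
  proof (induction k)
    case (Suc k)
    have "rising_fps (a + 1) $ Suc k = rising_fps (a + 1) $ k * (1 + a / real (Suc k))" by (rule *)
    also have "\<dots> \<le> (1 + a) ^ k * (1 + a)"
      using Suc assms by (intro mult_mono) (auto simp: divide_le_eq mult_left_le field_simps)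
    finally show ?case by (simp add: mult.commute)
  qed (simp add: rising_fps_nth)
  show ?thesis using \<open>J \<le> n\<close>
  proof (induction n rule: dec_induct)
    case base
    then show ?case using init[of J] \<open>0 < J\<close> by simp
  next
    case (step n)
    have "0 < n" using step \<open>0 < J\<close> by simp
    have "1 + a / real (Suc n) \<le> (real (Suc n) / real n) powr a"
    proof -
      have "1 + a / real (Suc n) \<le> exp (a * (1 / real (Suc n)))"
        using exp_ge_add_one_self[of "a * (1 / real (Suc n))"] by simp
      also have "\<dots> \<le> exp (a * ln (real (Suc n) / real n))"
      proof -
        have "ln (real n / real (Suc n)) \<le> real n / real (Suc n) - 1"
          using \<open>0 < n\<close> by (intro ln_le_minus_one) auto
        then have "1 / real (Suc n) \<le> - ln (real n / real (Suc n))"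
          by (simp add: field_simps)
        also have "\<dots> = ln (real (Suc n) / real n)"
          using \<open>0 < n\<close> by (simp add: ln_div)
        finally show ?thesis using assms(1) by (simp only: exp_le_cancel_iff mult_left_mono)
      qed
      finally show ?thesis using \<open>0 < n\<close> by (simp add: powr_def mult.commute)
    qed
    then have "rising_fps (a + 1) $ Suc n \<le> (1 + a) ^ J * (real n / real J) powr a * (real (Suc n) / real n) powr a"
      unfolding * using step assms by (intro mult_mono) auto
    also have "\<dots> = (1 + a) ^ J * (real (Suc n) / real J) powr a"
      using \<open>0 < n\<close> \<open>0 < J\<close> by (simp add: powr_mult[symmetric] mult.assoc)
    finally show ?case .
  qed
qed

section \<open>The difference scheme: positivity, monotonicity and bounds\<close>

lemma nonneg_quotient_fps:
  fixes W A B :: "real fps"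
  assumes eq: "W * B = A" and A: "\<And>n. 0 \<le> A $ n" and "0 < B $ 0" and B: "\<And>n. 0 < n \<Longrightarrow> B $ n \<le> 0"
  shows "0 \<le> W $ n"
proof (induction n rule: less_induct)
  case (less n)
  \<comment> \<open>Solved for \<open>W $ n\<close>, the convolution is a recursion in which the
    terms with \<open>i < n\<close> are nonpositive and enter with a minus sign: a discrete maximum
    principle.\<close>
  have "A $ n = (\<Sum>i\<le>n. W $ i * B $ (n - i))"
    by (simp add: eq[symmetric] fps_mult_nth atLeast0AtMost)
  also have "\<dots> = (\<Sum>i<n. W $ i * B $ (n - i)) + W $ n * B $ 0"
    by (simp add: lessThan_Suc_atMost[symmetric])
  finally have "W $ n * B $ 0 = A $ n - (\<Sum>i<n. W $ i * B $ (n - i))" by simp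
  moreover have "(\<Sum>i<n. W $ i * B $ (n - i)) \<le> 0"
    using less B by (intro sum_nonpos) (auto simp: mult_nonneg_nonpos)
  ultimately have "0 \<le> W $ n * B $ 0" using A[of n] by simp
  then show ?case using \<open>0 < B $ 0\<close> by (simp add: zero_le_mult_iff)
qed

text \<open>The solution after \<open>n\<close> steps of the backward difference scheme \<open>(1 - z)\<^sup>\<gamma> Y + \<mu> Y = (1 - z)\<^bsup>\<gamma> - 1\<^esup>\<close>
  for \<open>\<partial>\<^sub>t\<^sup>\<gamma> y = - \<lambda> y\<close>, \<open>y 0 = 1\<close>, with step size \<open>h\<close> and \<open>\<mu> = \<lambda> h\<^sup>\<gamma>\<close>.\<close>

definition discrete_ml :: "real \<Rightarrow> real \<Rightarrow> real fps" where
  "discrete_ml \<gamma> \<mu> = Abs_fps (\<lambda>n. \<Sum>k. (- \<mu>) ^ k * rising_fps (\<gamma> * real k + 1) $ n)"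

lemma summable_poly_geometric:
  fixes q c :: real
  assumes "0 \<le> q" "q < 1" "0 \<le> c"
  shows "summable (\<lambda>k. (1 + c * real k) ^ J * q ^ k)"
proof -
  have pos: "0 < 1 + c * real k" for k
    using assms by (simp add: add_pos_nonneg)
  have "(\<lambda>k. ((1 + c * real (Suc k)) / (1 + c * real k)) ^ J * q) \<longlonglongrightarrow> 1 ^ J * q"
  proof (intro tendsto_mult tendsto_power tendsto_const)
    show "(\<lambda>k. (1 + c * real (Suc k)) / (1 + c * real k)) \<longlonglongrightarrow> 1"
    proof (cases "c = 0")
      case False
      then have "0 < c" using assms by simp
      then show ?thesis by real_asymp
    qed simp
  qed
  then have "\<forall>\<^sub>F k in sequentially. ((1 + c * real (Suc k)) / (1 + c * real k)) ^ J * q < (1 + q) / 2"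
    by (rule order_tendstoD) (use assms in simp)
  then obtain N where N: "\<And>k. N \<le> k \<Longrightarrow> ((1 + c * real (Suc k)) / (1 + c * real k)) ^ J * q < (1 + q) / 2"
    by (auto simp: eventually_sequentially)
  show ?thesis
  proof (rule summable_ratio_test)
    show "(1 + q) / 2 < 1" using assms by simp
    fix k assume "N \<le> k"
  have "norm ((1 + c * real (Suc k)) ^ J * q ^ Suc k)
      = ((1 + c * real (Suc k)) / (1 + c * real k)) ^ J * q * ((1 + c * real k) ^ J * q ^ k)"
    using assms pos[of k] pos[of "Suc k"] by (simp add: abs_mult power_divide del: of_nat_Suc)
  also have "\<dots> \<le> (1 + q) / 2 * ((1 + c * real k) ^ J * q ^ k)"
    using assms pos[of k] N[OF \<open>N \<le> k\<close>] by (intro mult_right_mono) auto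
  also have "\<dots> = (1 + q) / 2 * norm ((1 + c * real k) ^ J * q ^ k)"
    using assms pos[of k] by (simp add: abs_mult)
  finally show "norm ((1 + c * real (Suc k)) ^ J * q ^ Suc k) \<le> (1 + q) / 2 * norm ((1 + c * real k) ^ J * q ^ k)" .
  qed
qed

lemma discrete_ml_summable:
  assumes "0 \<le> \<gamma>" "0 < \<mu>" "\<mu> < 1"
  shows "summable (\<lambda>k. (- \<mu>) ^ k * rising_fps (\<gamma> * real k + 1) $ n)"
proof (rule summable_comparison_test)
  show "\<exists>N. \<forall>k\<ge>N. norm ((- \<mu>) ^ k * rising_fps (\<gamma> * real k + 1) $ n) \<le> (1 + \<gamma> * real k) ^ Suc n * \<mu> ^ k"
  proof (intro exI allI impI)
    fix k :: nat assume "0 \<le> k"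
    have "rising_fps (\<gamma> * real k + 1) $ n \<le> (1 + \<gamma> * real k) ^ Suc n"
    proof (cases "n = 0")
      case False
      have "rising_fps (\<gamma> * real k + 1) $ n \<le> (1 + \<gamma> * real k) ^ n"
        using rising_fps_le[of "\<gamma> * real k" n n] False assms by simp
      also have "\<dots> \<le> (1 + \<gamma> * real k) ^ Suc n"
        using assms by (intro power_increasing) auto
      finally show ?thesis .
    qed (use assms in \<open>simp add: rising_fps_nth\<close>)
    then show "norm ((- \<mu>) ^ k * rising_fps (\<gamma> * real k + 1) $ n) \<le> (1 + \<gamma> * real k) ^ Suc n * \<mu> ^ k"
      using assms rising_fps_nonneg[of "\<gamma> * real k + 1" n]
      by (simp add: abs_mult power_abs mult.commute mult_left_mono del: power_Suc)
  qed
  show "summable (\<lambda>k. (1 + \<gamma> * real k) ^ Suc n * \<mu> ^ k)"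
    using assms by (intro summable_poly_geometric) auto
qed

text \<open>\<open>discrete_ml\<close> is the Neumann series of
  \<open>(1 - z) powr (-1) / (1 + \<mu> * (1 - z) powr (- \<gamma>))\<close>, the scheme multiplied
  by \<open>(1 - z) powr (- \<gamma>)\<close>. The second summand of the denominator shifts the
  series by one term with a minus sign, so only the term \<open>k = 0\<close> survives.\<close>

lemma discrete_ml_volterra:
  assumes "0 \<le> \<gamma>" "0 < \<mu>" "\<mu> < 1"
  shows "discrete_ml \<gamma> \<mu> * (1 + fps_const \<mu> * rising_fps \<gamma>) = rising_fps 1"
proof (rule fps_ext)
  fix n
  define t where "t k m = (- \<mu>) ^ k * rising_fps (\<gamma> * real k + 1) $ m" for k m
  have sm: "summable (\<lambda>k. t k m)" for m
    unfolding t_def by (rule discrete_ml_summable[OF assms])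
  have Z: "discrete_ml \<gamma> \<mu> $ m = (\<Sum>k. t k m)" for m
    by (simp add: discrete_ml_def t_def)
  have conv: "\<mu> * (\<Sum>i\<le>n. t k i * rising_fps \<gamma> $ (n - i)) = - t (Suc k) n" for k
  proof -
    have "(\<Sum>i\<le>n. t k i * rising_fps \<gamma> $ (n - i)) = (- \<mu>) ^ k * (rising_fps (\<gamma> * real k + 1) * rising_fps \<gamma>) $ n"
      by (simp add: t_def fps_mult_nth atLeast0AtMost sum_distrib_left mult.assoc)
    then show ?thesis by (simp add: rising_fps_mult t_def algebra_simps)
  qed
  have "(discrete_ml \<gamma> \<mu> * (1 + fps_const \<mu> * rising_fps \<gamma>)) $ n
      = (\<Sum>k. t k n) + \<mu> * (\<Sum>i\<le>n. (\<Sum>k. t k i) * rising_fps \<gamma> $ (n - i))"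
    by (simp add: distrib_left mult.left_commute[of _ "fps_const \<mu>"] Z fps_mult_nth[of "discrete_ml \<gamma> \<mu>"] atLeast0AtMost)
  also have "(\<Sum>i\<le>n. (\<Sum>k. t k i) * rising_fps \<gamma> $ (n - i)) = (\<Sum>k. \<Sum>i\<le>n. t k i * rising_fps \<gamma> $ (n - i))"
    by (simp add: suminf_sum suminf_mult2[OF sm] summable_mult2 sm)
  also have "\<mu> * \<dots> = (\<Sum>k. - t (Suc k) n)"
    by (simp only: conv[symmetric], rule suminf_mult[symmetric]) (intro summable_sum summable_mult2 sm)
  also have "\<dots> = - (\<Sum>k. t (Suc k) n)"
    by (rule suminf_minus) (rule summable_Suc_iff[THEN iffD2, OF sm])
  also have "(\<Sum>k. t (Suc k) n) = (\<Sum>k. t k n) - t 0 n"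
    by (rule suminf_split_head[OF sm])
  finally show "(discrete_ml \<gamma> \<mu> * (1 + fps_const \<mu> * rising_fps \<gamma>)) $ n = rising_fps 1 $ n"
    by (simp add: t_def)
qed

text \<open>Both bounds rest on monotonicity. In the Volterra equation, replacing every earlier
  value by the smallest one, the value at \<open>n\<close>, gives the upper bound. In the
  differential form the weights of the fractional derivative decrease, so it is at least the last
  weight times the total decrease of the solution; this gives the lower bound.\<close>

lemma discrete_ml_bounds:
  assumes \<gamma>: "0 < \<gamma>" "\<gamma> < 1" and \<mu>: "0 < \<mu>" "\<mu> < 1"
  shows "discrete_ml \<gamma> \<mu> $ n * (1 + \<mu> * rising_fps (\<gamma> + 1) $ n) \<le> 1"
    and "rising_fps (1 - \<gamma>) $ n \<le> discrete_ml \<gamma> \<mu> $ n * (\<mu> + rising_fps (1 - \<gamma>) $ n)"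
proof -
  define Z where "Z = discrete_ml \<gamma> \<mu>"
  \<comment> \<open>\<open>V\<close> holds the decrements \<open>Z $ (n - 1) - Z $ n\<close>, with
    \<open>1 - Z $ 0\<close> at index \<open>0\<close>: the initial value \<open>1\<close> sits
    before index \<open>0\<close>, so the partial sums of \<open>V\<close> are
    \<open>1 - Z $ n\<close>.\<close>
  define V where "V = 1 - rising_fps (-1) * Z"
  define D where "D = rising_fps (- \<gamma>) + fps_const \<mu>"
  have volterra: "Z * (1 + fps_const \<mu> * rising_fps \<gamma>) = rising_fps 1"
    using assms by (simp add: Z_def discrete_ml_volterra)
  have inv: "rising_fps \<gamma> * rising_fps (- \<gamma>) = 1"
    by (simp add: rising_fps_mult rising_fps_0)
  have "Z * D = Z * (1 + fps_const \<mu> * rising_fps \<gamma>) * rising_fps (- \<gamma>)"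
    using inv unfolding D_def by (simp add: algebra_simps)
  then have ZD: "Z * D = rising_fps (1 - \<gamma>)"
    by (simp add: volterra rising_fps_mult)
  \<comment> \<open>The decrements satisfy the scheme with right-hand side \<open>\<mu>\<close>, so
    the sign pattern of \<open>D\<close> makes them nonnegative just as it does for
    \<open>Z\<close>.\<close>
  have "V * D = D - rising_fps (-1) * (Z * D)"
    by (simp add: V_def algebra_simps)
  then have VD: "V * D = fps_const \<mu>"
    by (simp only: ZD rising_fps_mult) (simp add: D_def)
  have D0: "0 < D $ 0" using \<mu> by (simp add: D_def rising_fps_nth)
  have D_neg: "D $ n \<le> 0" if "0 < n" for n
    using rising_fps_minus_nonpos[of \<gamma> n] \<gamma> that by (simp add: D_def)
  have Z_nonneg: "0 \<le> Z $ n" for n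
    by (rule nonneg_quotient_fps[OF ZD _ D0 D_neg]) (use \<gamma> in \<open>auto intro: rising_fps_nonneg\<close>)
  have V_nonneg: "0 \<le> V $ n" for n
    by (rule nonneg_quotient_fps[OF VD _ D0 D_neg]) (use \<mu> in auto)
  have Z_Suc: "Z $ Suc m \<le> Z $ m" for m
    using V_nonneg[of "Suc m"] by (simp add: V_def rising_fps_minus_1 left_diff_distrib)
  have Z_antimono: "Z $ n \<le> Z $ m" if "m \<le> n" for m n
    using Z_Suc that by (rule lift_Suc_antimono_le[of "\<lambda>k. Z $ k"])

  have "Z $ n * (1 + \<mu> * rising_fps (\<gamma> + 1) $ n) = Z $ n + \<mu> * (\<Sum>i\<le>n. Z $ n * rising_fps \<gamma> $ i)"
  proof -
    have "rising_fps (\<gamma> + 1) $ n = (\<Sum>i\<le>n. rising_fps \<gamma> $ i)"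
      by (simp add: rising_fps_mult[symmetric] fps_mult_nth rising_fps_1_nth atLeast0AtMost)
    then show ?thesis by (simp add: algebra_simps sum_distrib_left)
  qed
  also have "\<dots> \<le> Z $ n + \<mu> * (\<Sum>i\<le>n. Z $ (n - i) * rising_fps \<gamma> $ i)"
    using \<mu> \<gamma> by (intro add_left_mono mult_left_mono sum_mono mult_right_mono Z_antimono rising_fps_nonneg) auto
  also have "\<dots> = (Z * (1 + fps_const \<mu> * rising_fps \<gamma>)) $ n"
  proof -
    have "Z * (1 + fps_const \<mu> * rising_fps \<gamma>) = Z + fps_const \<mu> * (rising_fps \<gamma> * Z)"
      by (simp add: algebra_simps)
    moreover have "(rising_fps \<gamma> * Z) $ n = (\<Sum>i\<le>n. Z $ (n - i) * rising_fps \<gamma> $ i)"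
      by (simp add: fps_mult_nth atLeast0AtMost mult.commute[of "Z $ _"])
    ultimately show ?thesis by simp
  qed
  finally show "discrete_ml \<gamma> \<mu> $ n * (1 + \<mu> * rising_fps (\<gamma> + 1) $ n) \<le> 1"
    by (simp only: volterra rising_fps_1_nth) (simp add: Z_def)

  have "rising_fps 1 * V = rising_fps 1 - Z"
    by (simp add: V_def right_diff_distrib mult.assoc[symmetric] rising_fps_mult rising_fps_0)
  then have "(rising_fps 1 * V) $ n = 1 - Z $ n"
    by (simp add: rising_fps_1_nth)
  then have sumV: "(\<Sum>i\<le>n. V $ (n - i)) = 1 - Z $ n"
    by (simp add: fps_mult_nth rising_fps_1_nth atLeast0AtMost)
  have "fps_const \<mu> * Z = rising_fps (1 - \<gamma>) * V"
  proof -
    have "rising_fps (1 - \<gamma>) * V = Z * (V * D)"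
      by (simp only: ZD[symmetric] mult.assoc mult.commute[of V D])
    then show ?thesis unfolding VD by (simp only: mult.commute)
  qed
  then have "\<mu> * Z $ n = (rising_fps (1 - \<gamma>) * V) $ n"
    by (metis fps_mult_left_const_nth)
  also have "\<dots> = (\<Sum>i\<le>n. rising_fps (1 - \<gamma>) $ i * V $ (n - i))"
    by (simp add: fps_mult_nth atLeast0AtMost)
  also have "\<dots> \<ge> (\<Sum>i\<le>n. rising_fps (1 - \<gamma>) $ n * V $ (n - i))"
    using \<gamma> V_nonneg by (intro sum_mono mult_right_mono rising_fps_antimono) auto
  also have "(\<Sum>i\<le>n. rising_fps (1 - \<gamma>) $ n * V $ (n - i)) = rising_fps (1 - \<gamma>) $ n * (1 - Z $ n)"
    by (simp add: sum_distrib_left[symmetric] sumV)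
  finally show "rising_fps (1 - \<gamma>) $ n \<le> discrete_ml \<gamma> \<mu> $ n * (\<mu> + rising_fps (1 - \<gamma>) $ n)"
    by (simp add: Z_def algebra_simps)
qed

section \<open>Passage from the scheme to the Mittag-Leffler function\<close>

lemma discrete_ml_tendsto:
  assumes \<gamma>: "0 < \<gamma>" and x: "0 < x"
  shows "(\<lambda>n. discrete_ml \<gamma> (x * real n powr - \<gamma>) $ n) \<longlonglongrightarrow> mittag_leffler \<gamma> 1 (- x)"
proof -
  define a where "a k n = (- (x * real n powr - \<gamma>)) ^ k * rising_fps (\<gamma> * real k + 1) $ n" for k n
  have "(\<lambda>n. x * real n powr - \<gamma>) \<longlonglongrightarrow> 0"
    using \<gamma> by real_asymp
  then have "\<forall>\<^sub>F J in sequentially. x * real J powr - \<gamma> < 1"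
    by (rule order_tendstoD) simp
  then obtain J where J: "0 < J" "x * real J powr - \<gamma> < 1"
    by (metis (no_types, lifting) eventually_gt_at_top eventually_conj eventually_happens' trivial_limit_sequentially)
  \<comment> \<open>\<open>J\<close> is fixed before \<open>k\<close> and \<open>n\<close>. Through
    the growth bound for the coefficients it turns
    \<open>x ^ k * real n powr - (\<gamma> * real k)\<close> into \<open>q ^ k\<close>, at the price
    of a factor polynomial in \<open>k\<close>.\<close>
  define q where "q = x * real J powr - \<gamma>"
  have q: "0 \<le> q" "q < 1" using J x by (auto simp: q_def)
  have pw: "(real n powr - \<gamma>) ^ k = real n powr - (\<gamma> * real k)" if "0 < n" for k n
    using that by (simp add: powr_realpow[symmetric] powr_powr)
  have "(\<lambda>n. \<Sum>k. a k n) \<longlonglongrightarrow> (\<Sum>k. (- x) ^ k / Gamma (\<gamma> * real k + 1))"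
  \<comment> \<open>Each term converges by the asymptotics of the coefficients; the majorant is
    uniform in \<open>n \<ge> J\<close>, so limit and sum may be exchanged.\<close>
  proof (rule tannerys_theorem[THEN conjunct2, THEN conjunct2])
    show "a k \<longlonglongrightarrow> (- x) ^ k / Gamma (\<gamma> * real k + 1)" for k
    proof -
      have "(\<lambda>n. (- x) ^ k * (rising_fps (\<gamma> * real k + 1) $ n * real n powr (1 - (\<gamma> * real k + 1))))
         \<longlonglongrightarrow> (- x) ^ k * (1 / Gamma (\<gamma> * real k + 1))"
        using \<gamma> by (intro tendsto_mult_left rising_fps_asymp) (simp add: add_nonneg_pos)
      moreover have "\<forall>\<^sub>F n in sequentially. (- x) ^ k * (rising_fps (\<gamma> * real k + 1) $ n * real n powr (1 - (\<gamma> * real k + 1))) = a k n"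
      proof (rule eventually_mono[OF eventually_gt_at_top[of 0]])
        fix n :: nat assume "0 < n"
        have "(- (x * real n powr - \<gamma>)) ^ k = (- x) ^ k * (real n powr - \<gamma>) ^ k"
          by (metis mult_minus_left power_mult_distrib)
        then show "(- x) ^ k * (rising_fps (\<gamma> * real k + 1) $ n * real n powr (1 - (\<gamma> * real k + 1))) = a k n"
          by (simp add: a_def pw[OF \<open>0 < n\<close>])
      qed
      ultimately show ?thesis by (simp add: Lim_transform_eventually)
    qed
    show "\<forall>\<^sub>F (k, n) in at_top \<times>\<^sub>F sequentially. norm (a k n) \<le> (1 + \<gamma> * real k) ^ J * q ^ k"
    proof -
      have "norm (a k n) \<le> (1 + \<gamma> * real k) ^ J * q ^ k" if "J \<le> n" for k n
      proof -
        have n: "0 < n" using that J by simp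
        have "norm (a k n) = x ^ k * real n powr - (\<gamma> * real k) * rising_fps (\<gamma> * real k + 1) $ n"
          using x \<gamma> rising_fps_nonneg[of "\<gamma> * real k + 1" n]
          by (simp add: a_def abs_mult power_abs power_mult_distrib pw[OF n])
        also have "\<dots> \<le> x ^ k * real n powr - (\<gamma> * real k) * ((1 + \<gamma> * real k) ^ J * (real n / real J) powr (\<gamma> * real k))"
          using x \<gamma> J that by (intro mult_left_mono rising_fps_le) auto
        also have "\<dots> = (1 + \<gamma> * real k) ^ J * (x ^ k * real J powr - (\<gamma> * real k))"
          using n J by (simp add: powr_divide powr_minus field_simps)
        also have "x ^ k * real J powr - (\<gamma> * real k) = q ^ k"
          using J by (simp add: q_def power_mult_distrib pw)
        finally show ?thesis .
      qed
      then show ?thesis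
        unfolding eventually_prod_filter
        by (intro exI[of _ "\<lambda>_. True"] exI[of _ "\<lambda>n. J \<le> n"]) (auto simp: eventually_ge_at_top)
    qed
    show "summable (\<lambda>k. (1 + \<gamma> * real k) ^ J * q ^ k)"
      using q \<gamma> by (intro summable_poly_geometric) auto
  qed simp
  then show ?thesis
    by (simp add: a_def discrete_ml_def mittag_leffler_def)
qed

lemma mittag_leffler_bounds:
  assumes \<gamma>: "0 < \<gamma>" "\<gamma> < 1" and x: "0 \<le> x"
  shows "mittag_leffler \<gamma> 1 (- x) * (1 + x / Gamma (\<gamma> + 1)) \<le> 1"
    and "1 / Gamma (1 - \<gamma>) \<le> mittag_leffler \<gamma> 1 (- x) * (x + 1 / Gamma (1 - \<gamma>))"
proof -
  define E where "E = mittag_leffler \<gamma> 1 (- x)"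
  have "E * (1 + x / Gamma (\<gamma> + 1)) \<le> 1 \<and> 1 / Gamma (1 - \<gamma>) \<le> E * (x + 1 / Gamma (1 - \<gamma>))"
  \<comment> \<open>The discrete bounds require a positive \<open>\<mu>\<close>, so the value at
    \<open>0\<close> is read off the power series instead.\<close>
  proof (cases "x = 0")
    case True
    have "E = 1"
      using powser_zero[of "\<lambda>k. 1 / Gamma (\<gamma> * real k + 1)"] True
      by (simp add: E_def mittag_leffler_def)
    then show ?thesis using True by simp
  next
    case False
    then have x: "0 < x" using assms by simp
    define \<mu> where "\<mu> n = x * real n powr - \<gamma>" for n
    have lim: "(\<lambda>n. discrete_ml \<gamma> (\<mu> n) $ n) \<longlonglongrightarrow> E"
      unfolding \<mu>_def E_def using \<gamma> x by (intro discrete_ml_tendsto)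
    have "\<mu> \<longlonglongrightarrow> 0"
      unfolding \<mu>_def using \<gamma> by real_asymp
    then have "\<forall>\<^sub>F n in sequentially. \<mu> n < 1"
      by (rule order_tendstoD) simp
    then have ev: "\<forall>\<^sub>F n in sequentially. 0 < n \<and> 0 < \<mu> n \<and> \<mu> n < 1"
      by (rule eventually_elim2[OF _ eventually_gt_at_top[of 0]]) (use x in \<open>auto simp: \<mu>_def\<close>)
    have "(\<lambda>n. rising_fps (\<gamma> + 1) $ n * real n powr (1 - (\<gamma> + 1))) \<longlonglongrightarrow> 1 / Gamma (\<gamma> + 1)"
      using \<gamma> by (intro rising_fps_asymp) simp
    then have "(\<lambda>n. x * (rising_fps (\<gamma> + 1) $ n * real n powr (1 - (\<gamma> + 1)))) \<longlonglongrightarrow> x * (1 / Gamma (\<gamma> + 1))"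
      by (rule tendsto_mult_left)
    then have up: "(\<lambda>n. \<mu> n * rising_fps (\<gamma> + 1) $ n) \<longlonglongrightarrow> x / Gamma (\<gamma> + 1)"
      by (simp add: \<mu>_def mult_ac)
    have lo: "(\<lambda>n. rising_fps (1 - \<gamma>) $ n * real n powr \<gamma>) \<longlonglongrightarrow> 1 / Gamma (1 - \<gamma>)"
      using rising_fps_asymp[of "1 - \<gamma>"] \<gamma> by simp
    have "E * (1 + x / Gamma (\<gamma> + 1)) \<le> 1"
    proof (rule tendsto_upperbound)
      show "(\<lambda>n. discrete_ml \<gamma> (\<mu> n) $ n * (1 + \<mu> n * rising_fps (\<gamma> + 1) $ n)) \<longlonglongrightarrow> E * (1 + x / Gamma (\<gamma> + 1))"
        by (intro tendsto_intros lim up)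
      show "\<forall>\<^sub>F n in sequentially. discrete_ml \<gamma> (\<mu> n) $ n * (1 + \<mu> n * rising_fps (\<gamma> + 1) $ n) \<le> 1"
        using ev by eventually_elim (use \<gamma> in \<open>auto intro: discrete_ml_bounds\<close>)
    qed simp
    \<comment> \<open>The coefficients for \<open>1 - \<gamma>\<close> decay like
      \<open>real n powr - \<gamma>\<close>. Multiplying the discrete inequality by
      \<open>real n powr \<gamma>\<close> gives it a nonzero limit and turns \<open>\<mu> n\<close>
      into \<open>x\<close>.\<close>
    moreover have "1 / Gamma (1 - \<gamma>) \<le> E * (x + 1 / Gamma (1 - \<gamma>))"
    proof (rule tendsto_le[OF _ _ lo])
      show "(\<lambda>n. discrete_ml \<gamma> (\<mu> n) $ n * (x + rising_fps (1 - \<gamma>) $ n * real n powr \<gamma>)) \<longlonglongrightarrow> E * (x + 1 / Gamma (1 - \<gamma>))"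
        by (intro tendsto_intros lim lo)
      show "\<forall>\<^sub>F n in sequentially. rising_fps (1 - \<gamma>) $ n * real n powr \<gamma>
          \<le> discrete_ml \<gamma> (\<mu> n) $ n * (x + rising_fps (1 - \<gamma>) $ n * real n powr \<gamma>)"
        using ev
      proof eventually_elim
        case (elim n)
        have "rising_fps (1 - \<gamma>) $ n * real n powr \<gamma>
            \<le> discrete_ml \<gamma> (\<mu> n) $ n * (\<mu> n + rising_fps (1 - \<gamma>) $ n) * real n powr \<gamma>"
          using elim \<gamma> by (intro mult_right_mono discrete_ml_bounds) auto
        also have "\<mu> n * real n powr \<gamma> = x"
          using elim by (simp add: \<mu>_def powr_minus)
        then have "discrete_ml \<gamma> (\<mu> n) $ n * (\<mu> n + rising_fps (1 - \<gamma>) $ n) * real n powr \<gamma>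
          = discrete_ml \<gamma> (\<mu> n) $ n * (x + rising_fps (1 - \<gamma>) $ n * real n powr \<gamma>)"
          by (simp add: algebra_simps)
        finally show ?case .
      qed
    qed simp
    ultimately show ?thesis by blast
  qed
  then show "mittag_leffler \<gamma> 1 (- x) * (1 + x / Gamma (\<gamma> + 1)) \<le> 1"
    and "1 / Gamma (1 - \<gamma>) \<le> mittag_leffler \<gamma> 1 (- x) * (x + 1 / Gamma (1 - \<gamma>))"
    by (auto simp: E_def)
qed

unbundle no fps_syntax
unbundle vec_syntax

section \<open>Plancherel's inequality for integrable functions\<close>

lemma has_bochner_integral_prod_Basis:
  fixes h :: "'a::euclidean_space \<Rightarrow> real \<Rightarrow> complex"
  assumes "\<And>b. b \<in> Basis \<Longrightarrow> integrable lborel (h b)"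
  shows "has_bochner_integral lborel (\<lambda>x. \<Prod>b\<in>Basis. h b (x \<bullet> b)) (\<Prod>b\<in>Basis. integral\<^sup>L lborel (h b))"
proof -
  interpret product_sigma_finite "\<lambda>_::'a. lborel :: real measure" ..
  have [measurable]: "h b \<in> borel_measurable borel" if "b \<in> Basis" for b
    using assms[OF that] by (auto dest: borel_measurable_integrable)
  have eq: "(\<Prod>b\<in>Basis. h b ((\<Sum>b\<in>Basis. f b *\<^sub>R b) \<bullet> b)) = (\<Prod>b\<in>Basis. h b (f b))" for f :: "'a \<Rightarrow> real"
    by (intro prod.cong) (auto simp: inner_sum_left_Basis)
  have "has_bochner_integral (\<Pi>\<^sub>M b\<in>Basis. lborel) (\<lambda>f. \<Prod>b\<in>Basis. h b (f b)) (\<Prod>b\<in>Basis. integral\<^sup>L lborel (h b))"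
    using assms by (simp add: has_bochner_integral_iff product_integral_prod product_integrable_prod)
  then show ?thesis
    by (subst lborel_eq[where 'a='a], subst has_bochner_integral_distr) (auto simp: eq)
qed

text \<open>Rescaling the variable by \<open>sqrt \<epsilon>\<close> gives the characteristic
  function of the standard normal distribution at \<open>z / sqrt \<epsilon>\<close>. The factor
  \<open>sqrt (2 * pi)\<close> undoes the normalisation of the density, and
  \<open>1 / sqrt \<epsilon>\<close> is the Jacobian.\<close>

lemma has_bochner_integral_gaussian_fourier_real:
  fixes z :: real
  assumes "0 < \<epsilon>"
  shows "has_bochner_integral lborel (\<lambda>t. exp (\<i> * of_real (t * z)) * of_real (exp (- \<epsilon> * t\<^sup>2 / 2)))
     (of_real (sqrt (2 * pi / \<epsilon>) * exp (- z\<^sup>2 / (2 * \<epsilon>))))"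
proof -
  define c where "c = sqrt \<epsilon>"
  have c: "0 < c" "c\<^sup>2 = \<epsilon>" using assms by (auto simp: c_def)
  define F where "F x = complex_of_real (std_normal_density x) * iexp (z / c * x)" for x
  have "integrable std_normal_distribution (\<lambda>x. iexp (z / c * x))"
    by (intro prob_space.integrable_iexp real_distribution.axioms(1)[OF real_dist_normal_dist]) auto
  then have F: "integrable lborel F"
    by (simp add: integrable_density scaleR_conv_of_real F_def[abs_def])
  have "integral\<^sup>L lborel F = char std_normal_distribution (z / c)"
    by (simp add: char_def integral_density scaleR_conv_of_real F_def[abs_def])
  also have "\<dots> = of_real (exp (- z\<^sup>2 / (2 * \<epsilon>)))"
    using c by (simp add: char_std_normal_distribution power_divide mult.commute)
  finally have "has_bochner_integral lborel F (of_real (exp (- z\<^sup>2 / (2 * \<epsilon>))))"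
    using F by (simp add: has_bochner_integral_iff)
  then have "has_bochner_integral lborel (\<lambda>t. F (0 + c * t)) (of_real (exp (- z\<^sup>2 / (2 * \<epsilon>))) /\<^sub>R \<bar>c\<bar>)"
    using c by (subst (asm) lborel_has_bochner_integral_real_affine_iff[of c _ _ 0]) auto
  then have *: "has_bochner_integral lborel (\<lambda>t. of_real (sqrt (2 * pi)) * F (0 + c * t))
     (of_real (sqrt (2 * pi)) * (of_real (exp (- z\<^sup>2 / (2 * \<epsilon>))) /\<^sub>R \<bar>c\<bar>))"
    by (rule has_bochner_integral_mult_right)
  have integrand: "of_real (sqrt (2 * pi)) * F (0 + c * t) = exp (\<i> * of_real (t * z)) * of_real (exp (- \<epsilon> * t\<^sup>2 / 2))" for t
  proof -
    have density: "sqrt (2 * pi) * std_normal_density (c * t) = exp (- \<epsilon> * t\<^sup>2 / 2)"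
      using c by (simp add: std_normal_density_def power_mult_distrib)
    have arg: "z / c * (c * t) = t * z"
      using c by simp
    have "of_real (sqrt (2 * pi)) * F (0 + c * t)
        = of_real (sqrt (2 * pi) * std_normal_density (c * t)) * iexp (z / c * (c * t))"
      by (simp add: F_def)
    also have "\<dots> = of_real (exp (- \<epsilon> * t\<^sup>2 / 2)) * exp (\<i> * of_real (t * z))"
      unfolding density arg ..
    finally show ?thesis by (simp only: mult.commute)
  qed
  have val: "of_real (sqrt (2 * pi)) * (of_real (exp (- z\<^sup>2 / (2 * \<epsilon>))) /\<^sub>R \<bar>c\<bar>)
      = complex_of_real (sqrt (2 * pi / \<epsilon>) * exp (- z\<^sup>2 / (2 * \<epsilon>)))"
  proof -
    have "sqrt (2 * pi / \<epsilon>) = sqrt (2 * pi) / c"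
      by (simp add: c_def real_sqrt_divide)
    then have "sqrt (2 * pi / \<epsilon>) * exp (- z\<^sup>2 / (2 * \<epsilon>)) = sqrt (2 * pi) * (inverse c * exp (- z\<^sup>2 / (2 * \<epsilon>)))"
      by (simp only: divide_inverse mult.assoc)
    then show ?thesis
      using c by (simp only: scaleR_conv_of_real of_real_mult abs_of_pos)
  qed
  show ?thesis
    using * unfolding integrand val .
qed

lemma has_bochner_integral_gaussian_fourier:
  fixes z :: "'a::euclidean_space"
  assumes "0 < \<epsilon>"
  shows "has_bochner_integral lborel (\<lambda>\<xi>. exp (\<i> * of_real (\<xi> \<bullet> z)) * of_real (exp (- \<epsilon> * (norm \<xi>)\<^sup>2 / 2)))
     (of_real (sqrt (2 * pi / \<epsilon>) ^ DIM('a) * exp (- (norm z)\<^sup>2 / (2 * \<epsilon>))))"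
proof -
  have norm: "(norm x)\<^sup>2 = (\<Sum>b\<in>Basis. (x \<bullet> b)\<^sup>2)" for x :: 'a
    by (simp add: norm_eq_sqrt_inner euclidean_inner[of x x] sum_nonneg power2_eq_square)
  define h where "h b t = exp (\<i> * of_real (t * (z \<bullet> b))) * complex_of_real (exp (- \<epsilon> * t\<^sup>2 / 2))" for b t
  have h: "has_bochner_integral lborel (h b) (of_real (sqrt (2 * pi / \<epsilon>) * exp (- (z \<bullet> b)\<^sup>2 / (2 * \<epsilon>))))" for b
    unfolding h_def[abs_def] by (rule has_bochner_integral_gaussian_fourier_real[OF assms])
  have "has_bochner_integral lborel (\<lambda>x. \<Prod>b\<in>Basis. h b (x \<bullet> b)) (\<Prod>b\<in>Basis. integral\<^sup>L lborel (h b))"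
    using h by (intro has_bochner_integral_prod_Basis) (auto simp: has_bochner_integral_iff)
  moreover have "(\<Prod>b\<in>Basis. h b (x \<bullet> b)) = exp (\<i> * of_real (x \<bullet> z)) * of_real (exp (- \<epsilon> * (norm x)\<^sup>2 / 2))" for x
    unfolding norm euclidean_inner[of x z] h_def prod.distrib
    by (simp add: exp_sum[symmetric] sum_distrib_left sum_divide_distrib sum_negf of_real_exp[symmetric] flip: of_real_prod)
  moreover have "(\<Prod>b\<in>Basis. integral\<^sup>L lborel (h b)) = of_real (sqrt (2 * pi / \<epsilon>) ^ DIM('a) * exp (- (norm z)\<^sup>2 / (2 * \<epsilon>)))"
    unfolding norm has_bochner_integral_integral_eq[OF h]
    by (simp add: prod.distrib exp_sum[symmetric] sum_divide_distrib sum_negf flip: of_real_prod)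
  ultimately show ?thesis by simp
qed

text \<open>The Gaussian Fourier formula at \<open>z = 0\<close> with \<open>1 / \<epsilon>\<close>
  in place of \<open>\<epsilon>\<close>, combined with translation invariance.\<close>

lemma nn_integral_gaussian:
  fixes y :: "'a::euclidean_space"
  assumes "0 < \<epsilon>"
  shows "(\<integral>\<^sup>+ x. ennreal (exp (- (norm (x - y))\<^sup>2 / (2 * \<epsilon>))) \<partial>lborel) = ennreal (sqrt (2 * pi * \<epsilon>) ^ DIM('a))"
proof -
  let ?g = "\<lambda>x::'a. exp (- (norm x)\<^sup>2 / (2 * \<epsilon>))"
  have "has_bochner_integral lborel (\<lambda>x. complex_of_real (?g x)) (of_real (sqrt (2 * pi * \<epsilon>) ^ DIM('a)))"
    using has_bochner_integral_gaussian_fourier[of "1 / \<epsilon>" "0::'a"] assms by (simp add: mult.commute[of \<epsilon> 2])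
  then have "has_bochner_integral lborel (\<lambda>x. Re (complex_of_real (?g x))) (Re (of_real (sqrt (2 * pi * \<epsilon>) ^ DIM('a))))"
    by (rule has_bochner_integral_Re)
  then have g: "has_bochner_integral lborel ?g (sqrt (2 * pi * \<epsilon>) ^ DIM('a))" by simp
  have "(\<integral>\<^sup>+ x. ennreal (?g (x - y)) \<partial>lborel) = (\<integral>\<^sup>+ x. ennreal (?g (x - y)) \<partial>distr lborel borel ((+) y))"
    by (simp add: lborel_distr_plus)
  also have "\<dots> = (\<integral>\<^sup>+ x. ennreal (?g x) \<partial>lborel)"
    by (subst nn_integral_distr) auto
  also have "\<dots> = ennreal (sqrt (2 * pi * \<epsilon>) ^ DIM('a))"
    using g by (simp add: has_bochner_integral_iff nn_integral_eq_integral)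
  finally show ?thesis .
qed

section \<open>Plancherel's inequality with and without the cut-off\<close>

lemma has_bochner_integral_lborel_times:
  fixes f :: "'a::euclidean_space \<Rightarrow> complex" and g :: "'b::euclidean_space \<Rightarrow> complex"
  assumes f: "integrable lborel f" and g: "integrable lborel g"
  shows "has_bochner_integral lborel (\<lambda>(x, y). f x * g y) (integral\<^sup>L lborel f * integral\<^sup>L lborel g)"
proof -
  have [measurable]: "f \<in> borel_measurable borel" "g \<in> borel_measurable borel"
    using f g by (auto dest: borel_measurable_integrable)
  have int: "integrable (lborel \<Otimes>\<^sub>M lborel) (\<lambda>(x, y). f x * g y)"
    using f g by (intro lborel_pair.Fubini_integrable) (auto simp: norm_mult)
  have "(\<integral>z. (case z of (x, y) \<Rightarrow> f x * g y) \<partial>(lborel \<Otimes>\<^sub>M lborel)) = integral\<^sup>L lborel f * integral\<^sup>L lborel g"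
    by (subst lborel_pair.integral_fst'[symmetric, OF int]) simp
  with int show ?thesis
    by (simp add: has_bochner_integral_iff lborel_prod)
qed

lemma borel_measurable_fst_borel:
  "fst \<in> borel_measurable (borel :: ('a::topological_space \<times> 'b::topological_space) measure)"
  by (rule borel_measurable_continuous_onI) (rule continuous_on_fst[OF continuous_on_id])

lemma borel_measurable_snd_borel:
  "snd \<in> borel_measurable (borel :: ('a::topological_space \<times> 'b::topological_space) measure)"
  by (rule borel_measurable_continuous_onI) (rule continuous_on_snd[OF continuous_on_id])

text \<open>Schur's test: \<open>2 a b \<le> a\<^sup>2 + b\<^sup>2\<close>, and the kernel has the same mass in each variable.\<close>

lemma nn_integral_gaussian_kernel_le:
  fixes f :: "'a::euclidean_space \<Rightarrow> complex"
  assumes [measurable]: "f \<in> borel_measurable borel" and "0 < \<epsilon>"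
  shows "(\<integral>\<^sup>+ (x, y). ennreal (cmod (f x) * cmod (f y) * exp (- (norm (x - y))\<^sup>2 / (2 * \<epsilon>))) \<partial>lborel)
    \<le> ennreal (sqrt (2 * pi * \<epsilon>) ^ DIM('a)) * (\<integral>\<^sup>+ x. ennreal ((cmod (f x))\<^sup>2) \<partial>lborel)"
proof -
  define w where "w x y = exp (- (norm (x - y))\<^sup>2 / (2 * \<epsilon>))" for x y :: 'a
  define S where "S = ennreal (sqrt (2 * pi * \<epsilon>) ^ DIM('a))"
  define I where "I = (\<integral>\<^sup>+ x. ennreal ((cmod (f x))\<^sup>2) \<partial>lborel)"
  have w_sym: "w x y = w y x" for x y by (simp add: w_def norm_minus_commute)
  have S: "(\<integral>\<^sup>+ y. ennreal ((cmod (f x))\<^sup>2 * w y x) \<partial>lborel) = ennreal ((cmod (f x))\<^sup>2) * S" for x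
  proof -
    have "(\<integral>\<^sup>+ y. ennreal ((cmod (f x))\<^sup>2 * w y x) \<partial>lborel) = ennreal ((cmod (f x))\<^sup>2) * (\<integral>\<^sup>+ y. ennreal (w y x) \<partial>lborel)"
      by (subst nn_integral_cmult[symmetric]) (auto simp: w_def ennreal_mult)
    then show ?thesis by (simp only: w_def S_def nn_integral_gaussian[OF \<open>0 < \<epsilon>\<close>])
  qed
  have I1: "(\<integral>\<^sup>+ x. \<integral>\<^sup>+ y. ennreal ((cmod (f x))\<^sup>2 * w x y) \<partial>lborel \<partial>lborel) = I * S"
  proof -
    have "(\<integral>\<^sup>+ y. ennreal ((cmod (f x))\<^sup>2 * w x y) \<partial>lborel) = ennreal ((cmod (f x))\<^sup>2) * S" for x
      using S[of x] by (simp only: w_sym[of x])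
    then show ?thesis by (simp add: nn_integral_multc I_def)
  qed
  have I2: "(\<integral>\<^sup>+ x. \<integral>\<^sup>+ y. ennreal ((cmod (f y))\<^sup>2 * w x y) \<partial>lborel \<partial>lborel) = I * S"
  proof -
    have "(\<lambda>(x, y). ennreal ((cmod (f y))\<^sup>2 * w x y)) \<in> borel_measurable (lborel \<Otimes>\<^sub>M lborel)"
      unfolding w_def by measurable
    then have "(\<integral>\<^sup>+ x. \<integral>\<^sup>+ y. ennreal ((cmod (f y))\<^sup>2 * w x y) \<partial>lborel \<partial>lborel)
        = (\<integral>\<^sup>+ y. \<integral>\<^sup>+ x. ennreal ((cmod (f y))\<^sup>2 * w x y) \<partial>lborel \<partial>lborel)"
      by (rule lborel_pair.Fubini'[symmetric])
    then show ?thesis by (simp add: S nn_integral_multc I_def)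
  qed
  have "(\<integral>\<^sup>+ (x, y). ennreal (cmod (f x) * cmod (f y) * w x y) \<partial>lborel)
      = (\<integral>\<^sup>+ x. \<integral>\<^sup>+ y. ennreal (cmod (f x) * cmod (f y) * w x y) \<partial>lborel \<partial>lborel)"
    unfolding lborel_prod[symmetric] w_def by (subst lborel.nn_integral_fst[symmetric]) (auto simp: case_prod_beta')
  also have "\<dots> \<le> (\<integral>\<^sup>+ x. \<integral>\<^sup>+ y. ennreal (1 / 2) * (ennreal ((cmod (f x))\<^sup>2 * w x y) + ennreal ((cmod (f y))\<^sup>2 * w x y)) \<partial>lborel \<partial>lborel)"
  proof (intro nn_integral_mono)
    fix x y
    have "cmod (f x) * cmod (f y) * w x y \<le> ((cmod (f x))\<^sup>2 + (cmod (f y))\<^sup>2) / 2 * w x y"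
      using sum_squares_bound[of "cmod (f x)" "cmod (f y)"] by (intro mult_right_mono) (auto simp: w_def)
    also have "\<dots> = 1 / 2 * ((cmod (f x))\<^sup>2 * w x y + (cmod (f y))\<^sup>2 * w x y)"
      by (simp add: field_simps)
    finally have "ennreal (cmod (f x) * cmod (f y) * w x y) \<le> ennreal (1 / 2 * ((cmod (f x))\<^sup>2 * w x y + (cmod (f y))\<^sup>2 * w x y))"
      by (rule ennreal_leI)
    also have "\<dots> = ennreal (1 / 2) * (ennreal ((cmod (f x))\<^sup>2 * w x y) + ennreal ((cmod (f y))\<^sup>2 * w x y))"
      by (subst ennreal_mult, simp, simp add: w_def, subst ennreal_plus) (simp_all add: w_def)
    finally show "ennreal (cmod (f x) * cmod (f y) * w x y) \<le> \<dots>" .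
  qed
  also have "\<dots> = (\<integral>\<^sup>+ x. ennreal (1 / 2) * ((\<integral>\<^sup>+ y. ennreal ((cmod (f x))\<^sup>2 * w x y) \<partial>lborel) + (\<integral>\<^sup>+ y. ennreal ((cmod (f y))\<^sup>2 * w x y) \<partial>lborel)) \<partial>lborel)"
    by (intro nn_integral_cong) (simp add: nn_integral_cmult nn_integral_add w_def)
  also have "\<dots> = ennreal (1 / 2) * ((\<integral>\<^sup>+ x. \<integral>\<^sup>+ y. ennreal ((cmod (f x))\<^sup>2 * w x y) \<partial>lborel \<partial>lborel)
      + (\<integral>\<^sup>+ x. \<integral>\<^sup>+ y. ennreal ((cmod (f y))\<^sup>2 * w x y) \<partial>lborel \<partial>lborel))"
    by (simp add: nn_integral_cmult nn_integral_add w_def)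
  also have "\<dots> = ennreal (1 / 2) * (I * S + I * S)"
    by (simp only: I1 I2)
  also have "\<dots> = ennreal (1 / 2) * ennreal 2 * (I * S)"
    by (simp add: mult_2[symmetric] mult.assoc)
  also have "ennreal (1 / 2) * ennreal 2 = ennreal (1 / 2 * 2)"
    by (rule ennreal_mult[symmetric]) auto
  also have "ennreal (1 / 2 * 2) * (I * S) = S * I"
    by (simp add: mult.commute)
  finally show ?thesis by (simp add: w_def S_def I_def)
qed

text \<open>As a double integral, the squared modulus is \<open>f x * cnj (f y)\<close> against an
  oscillation in \<xi>, and the Gaussian factor makes the integral over \<xi> absolutely convergent.
  The result is \<open>K\<close> times a Gaussian kernel in \<open>x - y\<close>, to which Schur's
  test applies. The mass of the kernel cancels the power of \<epsilon> in \<open>K\<close>, so the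
  constant does not depend on \<epsilon>.\<close>

lemma fourier_gaussian_le:
  fixes f :: "'a::euclidean_space \<Rightarrow> complex"
  assumes f: "integrable lborel f" and "0 < \<epsilon>"
  shows "(\<integral>\<^sup>+ \<xi>. ennreal ((cmod (\<integral>x. f x * exp (- \<i> * of_real (x \<bullet> \<xi>)) \<partial>lborel))\<^sup>2 * exp (- \<epsilon> * (norm \<xi>)\<^sup>2 / 2)) \<partial>lborel)
    \<le> ennreal ((2 * pi) ^ DIM('a)) * (\<integral>\<^sup>+ x. ennreal ((cmod (f x))\<^sup>2) \<partial>lborel)"
proof -
  note [measurable] = borel_measurable_fst_borel borel_measurable_snd_borel
  have [measurable]: "f \<in> borel_measurable borel"
    using f by (auto dest: borel_measurable_integrable)
  define g where "g \<xi> = exp (- \<epsilon> * (norm \<xi>)\<^sup>2 / 2)" for \<xi> :: 'a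
  define e where "e t = exp (- \<i> * of_real t)" for t
  have [measurable]: "g \<in> borel_measurable borel" "e \<in> borel_measurable borel"
    unfolding g_def[abs_def] e_def[abs_def] by measurable
  have [measurable]: "cnj \<in> borel_measurable borel"
    by (intro borel_measurable_continuous_onI continuous_intros)
  define h where "h = (\<lambda>(x, y). f x * cnj (f y))"
  have [measurable]: "h \<in> borel_measurable borel"
    unfolding h_def case_prod_beta' by measurable
  have cnjf: "integrable lborel (\<lambda>x. cnj (f x))" using f by simp
  have h: "integrable lborel h"
    using has_bochner_integral_lborel_times[OF f cnjf] by (simp add: h_def has_bochner_integral_iff)
  define Fh where "Fh \<xi> = (\<integral>x. f x * e (x \<bullet> \<xi>) \<partial>lborel)" for \<xi>
  define k where "k p \<xi> = e ((fst p - snd p) \<bullet> \<xi>) * of_real (g \<xi>)" for p :: "'a \<times> 'a" and \<xi>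
  define K where "K = sqrt (2 * pi / \<epsilon>) ^ DIM('a)"
  have "0 \<le> K" using assms by (simp add: K_def)
  define w where "w p = exp (- (norm (fst p - snd p))\<^sup>2 / (2 * \<epsilon>))" for p :: "'a \<times> 'a"
  have norm_e: "cmod (e t) = 1" for t by (simp add: e_def norm_exp)
  have k: "has_bochner_integral lborel (k p) (of_real (K * w p))" for p
  proof -
    have "e ((fst p - snd p) \<bullet> \<xi>) = exp (\<i> * of_real (\<xi> \<bullet> (snd p - fst p)))" for \<xi>
      by (simp add: e_def inner_commute[of _ \<xi>] inner_diff_right algebra_simps)
    then show ?thesis
      using has_bochner_integral_gaussian_fourier[OF \<open>0 < \<epsilon>\<close>, of "snd p - fst p"]
      by (simp add: k_def[abs_def] K_def w_def g_def norm_minus_commute)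
  qed
  have g_int: "integrable lborel (\<lambda>\<xi>. complex_of_real (g \<xi>))"
    using has_bochner_integral_gaussian_fourier[OF \<open>0 < \<epsilon>\<close>, of "0::'a"]
    by (simp add: g_def[abs_def] has_bochner_integral_iff)
  \<comment> \<open>Absolute integrability in all three variables: the oscillation has modulus one,
    so \<open>h\<close> times the Gaussian is a majorant.\<close>
  have hk_int: "integrable (lborel \<Otimes>\<^sub>M lborel) (\<lambda>(p, \<xi>). h p * k p \<xi>)"
  proof (rule Bochner_Integration.integrable_bound)
    show "integrable (lborel \<Otimes>\<^sub>M lborel) (\<lambda>(p, \<xi>). h p * complex_of_real (g \<xi>))"
      using has_bochner_integral_lborel_times[OF h g_int] by (simp add: lborel_prod has_bochner_integral_iff)
    show "(\<lambda>(p, \<xi>). h p * k p \<xi>) \<in> borel_measurable (lborel \<Otimes>\<^sub>M lborel)"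
      unfolding k_def lborel_prod case_prod_beta' by measurable
  qed (auto simp: k_def norm_mult norm_e)
  have Fh2: "(\<integral>p. h p * k p \<xi> \<partial>lborel) = of_real ((cmod (Fh \<xi>))\<^sup>2 * g \<xi>)" for \<xi>
  proof -
    have 1: "integrable lborel (\<lambda>x. f x * e (x \<bullet> \<xi>))"
      by (rule Bochner_Integration.integrable_bound[OF f]) (auto simp: norm_mult norm_e)
    then have 2: "integrable lborel (\<lambda>x. cnj (f x * e (x \<bullet> \<xi>)))"
      by (simp del: complex_cnj_mult)
    have "h p * k p \<xi> = (case p of (x, y) \<Rightarrow> (f x * e (x \<bullet> \<xi>)) * cnj (f y * e (y \<bullet> \<xi>))) * of_real (g \<xi>)" for p
      by (cases p) (simp add: h_def k_def e_def exp_cnj exp_add[symmetric] inner_diff_left algebra_simps)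
    then have "(\<integral>p. h p * k p \<xi> \<partial>lborel) = Fh \<xi> * cnj (Fh \<xi>) * of_real (g \<xi>)"
      using has_bochner_integral_integral_eq[OF has_bochner_integral_lborel_times[OF 1 2]]
      by (simp only: integral_mult_left_zero Bochner_Integration.integral_cnj Fh_def)
    then show ?thesis by (simp only: of_real_mult complex_norm_square)
  qed
  have nonneg: "0 \<le> (cmod (Fh \<xi>))\<^sup>2 * g \<xi>" for \<xi> by (simp add: g_def)
  have "integrable lborel (\<lambda>\<xi>. complex_of_real ((cmod (Fh \<xi>))\<^sup>2 * g \<xi>))"
    using lborel_pair.integrable_snd[OF hk_int] by (simp only: Fh2)
  then have "integrable lborel (\<lambda>\<xi>. Re (complex_of_real ((cmod (Fh \<xi>))\<^sup>2 * g \<xi>)))"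
    by (rule integrable_Re)
  then have Fh_int: "integrable lborel (\<lambda>\<xi>. (cmod (Fh \<xi>))\<^sup>2 * g \<xi>)" by simp
  have "complex_of_real (\<integral>\<xi>. (cmod (Fh \<xi>))\<^sup>2 * g \<xi> \<partial>lborel) = (\<integral>\<xi>. \<integral>p. h p * k p \<xi> \<partial>lborel \<partial>lborel)"
    by (simp only: Fh2 integral_complex_of_real)
  also have "\<dots> = (\<integral>p. \<integral>\<xi>. h p * k p \<xi> \<partial>lborel \<partial>lborel)"
    by (rule lborel_pair.Fubini_integral[OF hk_int])
  also have "\<dots> = of_real K * (\<integral>p. h p * of_real (w p) \<partial>lborel)"
    by (simp only: of_real_mult mult.left_commute[of _ "of_real K"] integral_mult_right_zero has_bochner_integral_integral_eq[OF k])
  finally have *: "complex_of_real (\<integral>\<xi>. (cmod (Fh \<xi>))\<^sup>2 * g \<xi> \<partial>lborel) = of_real K * (\<integral>p. h p * of_real (w p) \<partial>lborel)" .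
  have w: "0 \<le> w p" "w p \<le> 1" for p
    using \<open>0 < \<epsilon>\<close> by (auto simp: w_def)
  have hw_int: "integrable lborel (\<lambda>p. h p * of_real (w p))"
  proof (rule Bochner_Integration.integrable_bound[OF h])
    show "AE p in lborel. cmod (h p * of_real (w p)) \<le> cmod (h p)"
      using w by (simp add: norm_mult mult_left_le)
  qed (simp add: w_def)
  have "(\<integral>\<^sup>+ \<xi>. ennreal ((cmod (Fh \<xi>))\<^sup>2 * g \<xi>) \<partial>lborel) = ennreal (\<integral>\<xi>. (cmod (Fh \<xi>))\<^sup>2 * g \<xi> \<partial>lborel)"
    using Fh_int nonneg by (intro nn_integral_eq_integral) auto
  also have "\<dots> \<le> ennreal (cmod (of_real K * (\<integral>p. h p * of_real (w p) \<partial>lborel)))"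
    unfolding *[symmetric] by (intro ennreal_leI) simp
  also have "\<dots> = ennreal K * ennreal (cmod (\<integral>p. h p * of_real (w p) \<partial>lborel))"
    using \<open>0 \<le> K\<close> by (simp add: norm_mult ennreal_mult)
  also have "\<dots> \<le> ennreal K * (\<integral>\<^sup>+ p. ennreal (cmod (h p * of_real (w p))) \<partial>lborel)"
    by (intro mult_left_mono integral_norm_bound_ennreal hw_int) simp
  also have "(\<integral>\<^sup>+ p. ennreal (cmod (h p * of_real (w p))) \<partial>lborel)
      = (\<integral>\<^sup>+ (x, y). ennreal (cmod (f x) * cmod (f y) * exp (- (norm (x - y))\<^sup>2 / (2 * \<epsilon>))) \<partial>lborel)"
    by (simp add: h_def w_def norm_mult case_prod_beta')
  also have "ennreal K * \<dots> \<le> ennreal K * (ennreal (sqrt (2 * pi * \<epsilon>) ^ DIM('a)) * (\<integral>\<^sup>+ x. ennreal ((cmod (f x))\<^sup>2) \<partial>lborel))"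
    by (intro mult_left_mono nn_integral_gaussian_kernel_le[OF _ \<open>0 < \<epsilon>\<close>]) auto
  also have "\<dots> = ennreal (K * sqrt (2 * pi * \<epsilon>) ^ DIM('a)) * (\<integral>\<^sup>+ x. ennreal ((cmod (f x))\<^sup>2) \<partial>lborel)"
    using \<open>0 \<le> K\<close> \<open>0 < \<epsilon>\<close> by (simp add: ennreal_mult mult.assoc)
  also have "K * sqrt (2 * pi * \<epsilon>) ^ DIM('a) = (2 * pi) ^ DIM('a)"
  proof -
    have "sqrt (2 * pi / \<epsilon>) * sqrt (2 * pi * \<epsilon>) = sqrt ((2 * pi)\<^sup>2)"
      using assms by (simp add: real_sqrt_mult[symmetric] power2_eq_square)
    then have "sqrt (2 * pi / \<epsilon>) * sqrt (2 * pi * \<epsilon>) = 2 * pi"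
      by (simp only: real_sqrt_abs) simp
    moreover have "K * sqrt (2 * pi * \<epsilon>) ^ DIM('a) = (sqrt (2 * pi / \<epsilon>) * sqrt (2 * pi * \<epsilon>)) ^ DIM('a)"
      by (simp only: K_def power_mult_distrib)
    ultimately show ?thesis by (simp only:)
  qed
  finally show ?thesis by (simp add: Fh_def e_def g_def)
qed

text \<open>The Gaussian bound is uniform in \<epsilon>, so Fatou's lemma along
  \<open>\<epsilon> = inverse (real (Suc n))\<close> removes the cut-off.\<close>

lemma plancherel_le_lborel:
  fixes f :: "'a::euclidean_space \<Rightarrow> complex"
  assumes f: "integrable lborel f"
  shows "(\<integral>\<^sup>+ \<xi>. ennreal ((cmod (\<integral>x. f x * exp (- \<i> * of_real (x \<bullet> \<xi>)) \<partial>lborel))\<^sup>2) \<partial>lborel)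
    \<le> ennreal ((2 * pi) ^ DIM('a)) * (\<integral>\<^sup>+ x. ennreal ((cmod (f x))\<^sup>2) \<partial>lborel)"
proof -
  have [measurable]: "f \<in> borel_measurable borel"
    using f by (auto dest: borel_measurable_integrable)
  define F where "F \<xi> = (cmod (\<integral>x. f x * exp (- \<i> * of_real (x \<bullet> \<xi>)) \<partial>lborel))\<^sup>2" for \<xi>
  have [measurable]: "F \<in> borel_measurable borel"
    unfolding F_def[abs_def] by measurable
  have lim: "(\<lambda>n. ennreal (F \<xi> * exp (- inverse (real (Suc n)) * (norm \<xi>)\<^sup>2 / 2))) \<longlonglongrightarrow> ennreal (F \<xi>)" for \<xi>
  proof (rule tendsto_ennrealI)
    have "(\<lambda>n. F \<xi> * exp (- inverse (real (Suc n)) * (norm \<xi>)\<^sup>2 / 2)) \<longlonglongrightarrow> F \<xi> * exp (- 0 * (norm \<xi>)\<^sup>2 / 2)"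
      by (intro tendsto_intros LIMSEQ_inverse_real_of_nat) simp
    then show "(\<lambda>n. F \<xi> * exp (- inverse (real (Suc n)) * (norm \<xi>)\<^sup>2 / 2)) \<longlonglongrightarrow> F \<xi>" by simp
  qed
  have "(\<integral>\<^sup>+ \<xi>. ennreal (F \<xi>) \<partial>lborel)
      = (\<integral>\<^sup>+ \<xi>. liminf (\<lambda>n. ennreal (F \<xi> * exp (- inverse (real (Suc n)) * (norm \<xi>)\<^sup>2 / 2))) \<partial>lborel)"
    by (simp only: lim_imp_Liminf[OF trivial_limit_sequentially lim])
  also have "\<dots> \<le> liminf (\<lambda>n. \<integral>\<^sup>+ \<xi>. ennreal (F \<xi> * exp (- inverse (real (Suc n)) * (norm \<xi>)\<^sup>2 / 2)) \<partial>lborel)"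
    by (rule nn_integral_liminf) measurable
  also have "\<dots> \<le> ennreal ((2 * pi) ^ DIM('a)) * (\<integral>\<^sup>+ x. ennreal ((cmod (f x))\<^sup>2) \<partial>lborel)"
    unfolding F_def by (intro Liminf_le always_eventually allI fourier_gaussian_le[OF f]) simp_all
  finally show ?thesis by (simp add: F_def)
qed

section \<open>The space of square integrable functions\<close>

lemma L2_measurable: "f \<in> L2 \<Longrightarrow> f \<in> borel_measurable lebesgue"
  by (simp add: L2_def)

lemma L2_iff_nn_integral:
  "f \<in> L2 \<longleftrightarrow> f \<in> borel_measurable lebesgue \<and> (\<integral>\<^sup>+ x. ennreal ((cmod (f x))\<^sup>2) \<partial>lebesgue) < \<infinity>"
  by (auto simp: L2_def integrable_iff_bounded)

lemma L2_norm_nonneg: "0 \<le> L2_norm f"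
  by (simp add: L2_norm_def)

lemma L2_norm_power2: "(L2_norm f)\<^sup>2 = (LINT x|lebesgue. (cmod (f x))\<^sup>2)"
  by (simp add: L2_norm_def)

lemma nn_integral_L2:
  assumes "f \<in> L2"
  shows "(\<integral>\<^sup>+ x. ennreal ((cmod (f x))\<^sup>2) \<partial>lebesgue) = ennreal ((L2_norm f)\<^sup>2)"
  using assms unfolding L2_norm_power2 L2_def by (intro nn_integral_eq_integral) auto

lemma L2_norm_le_of_nn_integral:
  assumes "f \<in> L2" "(\<integral>\<^sup>+ x. ennreal ((cmod (f x))\<^sup>2) \<partial>lebesgue) \<le> ennreal (c\<^sup>2)" "0 \<le> c"
  shows "L2_norm f \<le> c"
  using assms by (simp add: nn_integral_L2 L2_norm_nonneg power2_le_iff_abs_le)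

lemma L2_cmult_bound:
  assumes f: "f \<in> borel_measurable lebesgue" and g: "g \<in> L2" and "0 \<le> c"
    and le: "AE x in lebesgue. cmod (f x) \<le> c * cmod (g x)"
  shows "f \<in> L2" "L2_norm f \<le> c * L2_norm g"
proof -
  have "(\<integral>\<^sup>+ x. ennreal ((cmod (f x))\<^sup>2) \<partial>lebesgue) \<le> (\<integral>\<^sup>+ x. ennreal (c\<^sup>2) * ennreal ((cmod (g x))\<^sup>2) \<partial>lebesgue)"
    using le
  proof (intro nn_integral_mono_AE, eventually_elim)
    case (elim x)
    have "(cmod (f x))\<^sup>2 \<le> c\<^sup>2 * (cmod (g x))\<^sup>2"
      using power_mono[OF elim(2), of 2] by (simp add: power_mult_distrib)
    then have "ennreal ((cmod (f x))\<^sup>2) \<le> ennreal (c\<^sup>2 * (cmod (g x))\<^sup>2)"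
      by (rule ennreal_leI)
    then show ?case by (simp add: ennreal_mult)
  qed
  also have "\<dots> = ennreal (c\<^sup>2) * (\<integral>\<^sup>+ x. ennreal ((cmod (g x))\<^sup>2) \<partial>lebesgue)"
    using L2_measurable[OF g] by (intro nn_integral_cmult) measurable
  also have "\<dots> = ennreal ((c * L2_norm g)\<^sup>2)"
    by (simp add: nn_integral_L2[OF g] ennreal_mult[symmetric] power_mult_distrib)
  finally have *: "(\<integral>\<^sup>+ x. ennreal ((cmod (f x))\<^sup>2) \<partial>lebesgue) \<le> ennreal ((c * L2_norm g)\<^sup>2)" .
  then show "f \<in> L2"
    using f by (auto simp: L2_iff_nn_integral le_less_trans)
  then show "L2_norm f \<le> c * L2_norm g"
    using * by (rule L2_norm_le_of_nn_integral) (simp add: L2_norm_nonneg \<open>0 \<le> c\<close>)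
qed

lemma L2_norm_eq_0:
  assumes "f \<in> L2" "L2_norm f = 0"
  shows "AE x in lebesgue. f x = 0"
proof -
  have "(\<integral>\<^sup>+ x. ennreal ((cmod (f x))\<^sup>2) \<partial>lebesgue) = 0"
    using assms by (simp add: nn_integral_L2)
  then have "AE x in lebesgue. ennreal ((cmod (f x))\<^sup>2) = 0"
    using L2_measurable[OF assms(1)] by (subst (asm) nn_integral_0_iff_AE) auto
  then show ?thesis by (auto elim: eventually_mono)
qed

text \<open>Convexity of the square gives \<open>(a + b)\<^sup>2 / (A + B) \<le> a\<^sup>2 / A + b\<^sup>2 / B\<close>; integrating
  it with \<open>A\<close> and \<open>B\<close> slightly larger than the two norms gives the triangle inequality.\<close>

lemma L2_add:
  assumes f: "f \<in> L2" and g: "g \<in> L2"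
  shows "(\<lambda>x. f x + g x) \<in> L2" "L2_norm (\<lambda>x. f x + g x) \<le> L2_norm f + L2_norm g"
proof -
  note [measurable] = L2_measurable[OF f] L2_measurable[OF g]
  have *: "(\<integral>\<^sup>+ x. ennreal ((cmod (f x + g x))\<^sup>2) \<partial>lebesgue) \<le> ennreal ((A + B)\<^sup>2)"
    if A: "L2_norm f < A" and B: "L2_norm g < B" for A B
  proof -
    have pos: "0 < A" "0 < B" using A B L2_norm_nonneg[of f] L2_norm_nonneg[of g] by linarith+
    define P Q where "P = (A + B) / A" and "Q = (A + B) / B"
    have PQ: "0 \<le> P" "0 \<le> Q" using pos by (auto simp: P_def Q_def)
    have pt: "(cmod (f x + g x))\<^sup>2 \<le> P * (cmod (f x))\<^sup>2 + Q * (cmod (g x))\<^sup>2" for x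
    proof -
      let ?a = "cmod (f x)" and ?b = "cmod (g x)"
      have "P * ?a\<^sup>2 + Q * ?b\<^sup>2 - (?a + ?b)\<^sup>2 = (B * ?a - A * ?b)\<^sup>2 / (A * B)"
        using pos by (simp add: P_def Q_def field_simps power2_eq_square)
      also have "\<dots> \<ge> 0" using pos by simp
      finally have "(?a + ?b)\<^sup>2 \<le> P * ?a\<^sup>2 + Q * ?b\<^sup>2" by simp
      moreover have "(cmod (f x + g x))\<^sup>2 \<le> (?a + ?b)\<^sup>2"
        by (intro power_mono norm_triangle_ineq) simp
      ultimately show ?thesis by (rule order_trans[rotated])
    qed
    have "(\<integral>\<^sup>+ x. ennreal ((cmod (f x + g x))\<^sup>2) \<partial>lebesgue)
        \<le> (\<integral>\<^sup>+ x. ennreal P * ennreal ((cmod (f x))\<^sup>2) + ennreal Q * ennreal ((cmod (g x))\<^sup>2) \<partial>lebesgue)"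
    proof (rule nn_integral_mono)
      fix x
      have "ennreal ((cmod (f x + g x))\<^sup>2) \<le> ennreal (P * (cmod (f x))\<^sup>2 + Q * (cmod (g x))\<^sup>2)"
        by (rule ennreal_leI[OF pt])
      then show "ennreal ((cmod (f x + g x))\<^sup>2) \<le> ennreal P * ennreal ((cmod (f x))\<^sup>2) + ennreal Q * ennreal ((cmod (g x))\<^sup>2)"
        using PQ by (simp add: ennreal_mult)
    qed
    also have "\<dots> = ennreal P * ennreal ((L2_norm f)\<^sup>2) + ennreal Q * ennreal ((L2_norm g)\<^sup>2)"
      using f g by (subst nn_integral_add) (simp_all add: nn_integral_cmult nn_integral_L2)
    also have "\<dots> = ennreal (P * (L2_norm f)\<^sup>2 + Q * (L2_norm g)\<^sup>2)"
      using PQ by (simp add: ennreal_mult)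
    also have "\<dots> \<le> ennreal (P * A\<^sup>2 + Q * B\<^sup>2)"
      using PQ A B by (intro ennreal_leI add_mono mult_left_mono power_mono L2_norm_nonneg) auto
    also have "P * A\<^sup>2 + Q * B\<^sup>2 = (A + B)\<^sup>2"
      using pos by (simp add: P_def Q_def field_simps power2_eq_square)
    finally show ?thesis .
  qed
  show fg: "(\<lambda>x. f x + g x) \<in> L2"
    using *[of "L2_norm f + 1" "L2_norm g + 1"] by (auto simp: L2_iff_nn_integral le_less_trans)
  show "L2_norm (\<lambda>x. f x + g x) \<le> L2_norm f + L2_norm g"
  proof (rule field_le_epsilon)
    fix e :: real assume "0 < e"
    have "L2_norm (\<lambda>x. f x + g x) \<le> (L2_norm f + e / 2) + (L2_norm g + e / 2)"
      using \<open>0 < e\<close> by (intro L2_norm_le_of_nn_integral fg *) (auto simp: L2_norm_nonneg add_nonneg_nonneg)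
    then show "L2_norm (\<lambda>x. f x + g x) \<le> L2_norm f + L2_norm g + e" by simp
  qed
qed

lemma L2_minus:
  assumes "f \<in> L2" "g \<in> L2"
  shows "(\<lambda>x. f x - g x) \<in> L2" "L2_norm (\<lambda>x. f x - g x) \<le> L2_norm f + L2_norm g"
proof -
  have "(\<lambda>x. - g x) \<in> L2" "L2_norm (\<lambda>x. - g x) = L2_norm g"
    using assms by (auto simp: L2_def L2_norm_def)
  with L2_add[OF assms(1), of "\<lambda>x. - g x"] show "(\<lambda>x. f x - g x) \<in> L2" "L2_norm (\<lambda>x. f x - g x) \<le> L2_norm f + L2_norm g"
    by auto
qed

lemma L2_norm_minus_commute: "L2_norm (\<lambda>x. f x - g x) = L2_norm (\<lambda>x. g x - f x)"
  by (simp add: L2_norm_def norm_minus_commute)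

lemma L2_norm_triangle:
  assumes "f \<in> L2" "g \<in> L2" "h \<in> L2"
  shows "L2_norm (\<lambda>x. f x - h x) \<le> L2_norm (\<lambda>x. f x - g x) + L2_norm (\<lambda>x. g x - h x)"
  using L2_add(2)[OF L2_minus(1)[OF assms(1,2)] L2_minus(1)[OF assms(2,3)]] by simp

text \<open>A finite sum \<open>C\<close> bounds every term, hence the increments by
  \<open>sqrt C * (1 / sqrt 2) ^ k\<close>. The weight \<open>2 ^ k\<close> lets the completeness
  proof work with integrals of squares alone.\<close>

lemma convergent_if_weighted_square_summable:
  fixes y :: "nat \<Rightarrow> complex"
  assumes "(\<Sum>k. ennreal (2 ^ k * (cmod (y (Suc k) - y k))\<^sup>2)) \<noteq> \<infinity>"
  shows "convergent y"
proof -
  define a where "a k = ennreal (2 ^ k * (cmod (y (Suc k) - y k))\<^sup>2)" for k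
  have "suminf a \<noteq> \<infinity>" using assms by (simp only: a_def[abs_def] not_False_eq_True)
  then obtain C where "0 \<le> C" and C: "suminf a = ennreal C"
    by (cases "suminf a") auto
  have bound: "cmod (y (Suc k) - y k) \<le> sqrt C * (1 / sqrt 2) ^ k" for k
  proof -
    have "a k \<le> suminf a"
      using sum_le_suminf[of a "{k}"] by simp
    then have "ennreal (2 ^ k * (cmod (y (Suc k) - y k))\<^sup>2) \<le> ennreal C"
      by (simp only: a_def C)
    then have "2 ^ k * (cmod (y (Suc k) - y k))\<^sup>2 \<le> C"
      by (rule ennreal_le_iff[OF \<open>0 \<le> C\<close>, THEN iffD1])
    then have "(cmod (y (Suc k) - y k))\<^sup>2 \<le> C / 2 ^ k"
      by (subst pos_le_divide_eq) (simp_all only: mult.commute zero_less_power zero_less_numeral)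
    then have "sqrt ((cmod (y (Suc k) - y k))\<^sup>2) \<le> sqrt (C / 2 ^ k)"
      by (rule real_sqrt_le_mono)
    then show ?thesis by (simp add: real_sqrt_divide real_sqrt_power power_divide)
  qed
  have "summable (\<lambda>k. sqrt C * (1 / sqrt 2) ^ k)"
    by (intro summable_mult summable_geometric) simp
  then have "summable (\<lambda>k. y (Suc k) - y k)"
    by (rule summable_comparison_test'[of _ 0]) (use bound in auto)
  then have "convergent (\<lambda>n. \<Sum>k<n. y (Suc k) - y k)"
    by (rule summable_iff_convergent[THEN iffD1])
  then have "convergent (\<lambda>n. y n - y 0)"
    by (simp only: sum_lessThan_telescope)
  then show ?thesis
    using convergent_add[OF _ convergent_const[of "y 0"]] by fastforce
qed

text \<open>The Riesz-Fischer argument: a rapidly converging subsequence converges almost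
  everywhere, and Fatou's lemma identifies its limit as the norm limit of the whole
  sequence.\<close>

lemma L2_complete:
  fixes X :: "nat \<Rightarrow> real ^ 'n \<Rightarrow> complex"
  assumes X: "\<And>n. X n \<in> L2"
    and cauchy: "\<And>e. 0 < e \<Longrightarrow> \<exists>N. \<forall>m\<ge>N. \<forall>n\<ge>N. L2_norm (\<lambda>x. X m x - X n x) < e"
  shows "\<exists>F\<in>L2. (\<lambda>n. L2_norm (\<lambda>x. X n x - F x)) \<longlonglongrightarrow> 0"
proof -
  note [measurable] = L2_measurable[OF X]
  have "\<exists>r. \<forall>k. \<forall>m\<ge>r k. \<forall>n\<ge>r k. L2_norm (\<lambda>x. X m x - X n x) < (1 / 2) ^ k"
    using cauchy by (intro choice allI) simp
  then obtain r where r: "\<And>k m n. r k \<le> m \<Longrightarrow> r k \<le> n \<Longrightarrow> L2_norm (\<lambda>x. X m x - X n x) < (1 / 2) ^ k"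
    by blast
  \<comment> \<open>Adding \<open>k\<close> and all thresholds up to \<open>k\<close> makes the
    indices increase, tend to infinity and stay above \<open>r k\<close>.\<close>
  define s where "s k = k + (\<Sum>j\<le>k. r j)" for k
  have s: "r k \<le> s k" "s k \<le> s (Suc k)" "k \<le> s k" for k
    using member_le_sum[of k "{..k}" r] by (auto simp: s_def)
  define Y where "Y k = X (s k)" for k
  have [measurable]: "Y k \<in> borel_measurable lebesgue" for k by (simp add: Y_def)
  have diff: "(\<lambda>x. X m x - X n x) \<in> L2" for m n
    using X by (intro L2_minus)
  have "(\<integral>\<^sup>+ x. (\<Sum>k. ennreal (2 ^ k * (cmod (Y (Suc k) x - Y k x))\<^sup>2)) \<partial>lebesgue)
      = (\<Sum>k. \<integral>\<^sup>+ x. ennreal (2 ^ k * (cmod (Y (Suc k) x - Y k x))\<^sup>2) \<partial>lebesgue)"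
    by (rule nn_integral_suminf) measurable
  also have "\<dots> \<le> (\<Sum>k. ennreal ((1 / 2) ^ k))"
  proof (rule suminf_le)
    fix k
    have "(\<integral>\<^sup>+ x. ennreal (2 ^ k * (cmod (Y (Suc k) x - Y k x))\<^sup>2) \<partial>lebesgue)
        = (\<integral>\<^sup>+ x. ennreal (2 ^ k) * ennreal ((cmod (Y (Suc k) x - Y k x))\<^sup>2) \<partial>lebesgue)"
      by (simp add: ennreal_mult)
    also have "\<dots> = ennreal (2 ^ k) * (\<integral>\<^sup>+ x. ennreal ((cmod (Y (Suc k) x - Y k x))\<^sup>2) \<partial>lebesgue)"
      by (rule nn_integral_cmult) measurable
    also have "\<dots> = ennreal (2 ^ k) * ennreal ((L2_norm (\<lambda>x. Y (Suc k) x - Y k x))\<^sup>2)"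
      unfolding Y_def by (simp only: nn_integral_L2[OF diff])
    also have "\<dots> = ennreal (2 ^ k * (L2_norm (\<lambda>x. Y (Suc k) x - Y k x))\<^sup>2)"
      by (rule ennreal_mult[symmetric]) auto
    \<comment> \<open>The squared increments are at most \<open>(1 / 4) ^ k\<close>, which beats the
      weight \<open>2 ^ k\<close> and leaves a geometric series.\<close>
    also have "\<dots> \<le> ennreal (2 ^ k * ((1 / 2) ^ k)\<^sup>2)"
      unfolding Y_def using r[of k "s (Suc k)" "s k"] s[of k]
      by (intro ennreal_leI mult_left_mono power_mono L2_norm_nonneg) auto
    also have "2 ^ k * ((1 / 2) ^ k)\<^sup>2 = ((1 / 2) ^ k :: real)"
      by (simp add: power2_eq_square power_divide)
    finally show "(\<integral>\<^sup>+ x. ennreal (2 ^ k * (cmod (Y (Suc k) x - Y k x))\<^sup>2) \<partial>lebesgue) \<le> ennreal ((1 / 2) ^ k)" .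
  qed auto
  also have "\<dots> = ennreal (\<Sum>k. (1 / 2) ^ k)"
    by (rule suminf_ennreal2) (auto intro: summable_geometric)
  finally have fin: "(\<integral>\<^sup>+ x. (\<Sum>k. ennreal (2 ^ k * (cmod (Y (Suc k) x - Y k x))\<^sup>2)) \<partial>lebesgue) \<noteq> \<infinity>"
    by (auto simp: top_unique)
  have "AE x in lebesgue. (\<Sum>k. ennreal (2 ^ k * (cmod (Y (Suc k) x - Y k x))\<^sup>2)) \<noteq> \<infinity>"
    by (rule nn_integral_noteq_infinite[OF _ fin]) measurable
  then have conv: "AE x in lebesgue. (\<lambda>k. Y k x) \<longlonglongrightarrow> lim (\<lambda>k. Y k x)"
    by eventually_elim (simp add: convergent_if_weighted_square_summable convergent_LIMSEQ_iff[symmetric])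
  \<comment> \<open>Where the sequence diverges, \<open>lim\<close> is one fixed unspecified value,
    so \<open>F\<close> is measurable on the whole space.\<close>
  define F where "F x = lim (\<lambda>k. Y k x)" for x
  have [measurable]: "F \<in> borel_measurable lebesgue"
    unfolding F_def[abs_def] by (rule borel_measurable_lim_metric) measurable
  have close: "\<exists>N. \<forall>n\<ge>N. (\<integral>\<^sup>+ x. ennreal ((cmod (X n x - F x))\<^sup>2) \<partial>lebesgue) \<le> ennreal (e\<^sup>2)" if "0 < e" for e
  proof -
    obtain N where N: "\<And>m n. N \<le> m \<Longrightarrow> N \<le> n \<Longrightarrow> L2_norm (\<lambda>x. X m x - X n x) < e"
      using cauchy[OF \<open>0 < e\<close>] by blast
    have "(\<integral>\<^sup>+ x. ennreal ((cmod (X n x - F x))\<^sup>2) \<partial>lebesgue) \<le> ennreal (e\<^sup>2)" if "N \<le> n" for n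
    proof -
      have "(\<integral>\<^sup>+ x. ennreal ((cmod (X n x - F x))\<^sup>2) \<partial>lebesgue)
          = (\<integral>\<^sup>+ x. liminf (\<lambda>k. ennreal ((cmod (X n x - Y k x))\<^sup>2)) \<partial>lebesgue)"
        using conv
      proof (intro nn_integral_cong_AE, eventually_elim)
        case (elim x)
        then have "(\<lambda>k. ennreal ((cmod (X n x - Y k x))\<^sup>2)) \<longlonglongrightarrow> ennreal ((cmod (X n x - F x))\<^sup>2)"
          unfolding F_def by (intro tendsto_intros)
        then show ?case
          by (rule lim_imp_Liminf[OF trivial_limit_sequentially, symmetric])
      qed
      also have "\<dots> \<le> liminf (\<lambda>k. \<integral>\<^sup>+ x. ennreal ((cmod (X n x - Y k x))\<^sup>2) \<partial>lebesgue)"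
        by (rule nn_integral_liminf) measurable
      also have "\<dots> \<le> ennreal (e\<^sup>2)"
      proof (rule Liminf_le)
        show "\<forall>\<^sub>F k in sequentially. (\<integral>\<^sup>+ x. ennreal ((cmod (X n x - Y k x))\<^sup>2) \<partial>lebesgue) \<le> ennreal (e\<^sup>2)"
          using eventually_ge_at_top[of N]
        proof eventually_elim
          case (elim k)
          then have "N \<le> s k" using s(3)[of k] by simp
          then have "(L2_norm (\<lambda>x. X n x - Y k x))\<^sup>2 \<le> e\<^sup>2"
            unfolding Y_def using N[OF \<open>N \<le> n\<close>, of "s k"] by (intro power_mono L2_norm_nonneg) auto
          then show ?case unfolding Y_def by (simp only: nn_integral_L2[OF diff] ennreal_leI)
        qed
      qed simp
      finally show ?thesis .
    qed
    then show ?thesis by blast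
  qed
  obtain N where "(\<integral>\<^sup>+ x. ennreal ((cmod (X N x - F x))\<^sup>2) \<partial>lebesgue) \<le> ennreal (1\<^sup>2)"
    using close[of 1] by (meson order_refl zero_less_one)
  then have "(\<integral>\<^sup>+ x. ennreal ((cmod (X N x - F x))\<^sup>2) \<partial>lebesgue) < \<infinity>"
    by (rule le_less_trans) simp
  then have "(\<lambda>x. X N x - F x) \<in> L2"
    by (simp add: L2_iff_nn_integral)
  from L2_minus(1)[OF X[of N] this] have F: "F \<in> L2" by simp
  have "(\<lambda>n. L2_norm (\<lambda>x. X n x - F x)) \<longlonglongrightarrow> 0"
  proof (rule LIMSEQ_I)
    fix e :: real assume "0 < e"
    then obtain N where N: "\<And>n. N \<le> n \<Longrightarrow> (\<integral>\<^sup>+ x. ennreal ((cmod (X n x - F x))\<^sup>2) \<partial>lebesgue) \<le> ennreal ((e / 2)\<^sup>2)"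
      using close[of "e / 2"] by auto
    have "norm (L2_norm (\<lambda>x. X n x - F x) - 0) < e" if "N \<le> n" for n
      using L2_norm_le_of_nn_integral[OF L2_minus(1)[OF X F] N[OF that]] \<open>0 < e\<close> L2_norm_nonneg[of "\<lambda>x. X n x - F x"]
      by simp
    then show "\<exists>N. \<forall>n\<ge>N. norm (L2_norm (\<lambda>x. X n x - F x) - 0) < e" by blast
  qed
  with F show ?thesis by blast
qed

section \<open>The Fourier transform on square integrable functions\<close>

text \<open>The Gaussian estimates use Fubini's theorem over \<open>lborel\<close>, while
  \<open>L2\<close> consists of Lebesgue measurable functions; a Borel representative links the
  two.\<close>

lemma lebesgue_measurable_complex_ex_borel:
  fixes f :: "'a::euclidean_space \<Rightarrow> complex"
  assumes "f \<in> borel_measurable lebesgue"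
  obtains f' where "f' \<in> borel_measurable lborel" "AE x in lebesgue. f x = f' x"
proof -
  have "(\<lambda>x. Re (f x)) \<in> borel_measurable lebesgue" "(\<lambda>x. Im (f x)) \<in> borel_measurable lebesgue"
    using assms by measurable
  from this[THEN completion_ex_borel_measurable_real] obtain u v
    where uv: "u \<in> borel_measurable lborel" "v \<in> borel_measurable lborel"
      "AE x in lborel. Re (f x) = u x" "AE x in lborel. Im (f x) = v x"
    by blast
  have "AE x in lborel. f x = complex_of_real (u x) + \<i> * complex_of_real (v x)"
    using uv(3,4) by eventually_elim (simp add: complex_eq_iff)
  then show ?thesis
    using uv(1,2) by (intro that[of "\<lambda>x. complex_of_real (u x) + \<i> * complex_of_real (v x)"] AE_completion) auto
qed

lemma lebesgue_measurable_character:
  "(\<lambda>x. exp (- \<i> * of_real (x \<bullet> \<xi>))) \<in> borel_measurable lebesgue"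
  by (rule measurable_completion) measurable

lemma fourier_integral_cong_AE:
  assumes "f \<in> borel_measurable lebesgue" "g \<in> borel_measurable lebesgue" "AE x in lebesgue. f x = g x"
  shows "fourier_integral f = fourier_integral g"
proof -
  have "(LINT x|lebesgue. f x * exp (- \<i> * of_real (x \<bullet> \<xi>))) = (LINT x|lebesgue. g x * exp (- \<i> * of_real (x \<bullet> \<xi>)))" for \<xi>
  proof (rule integral_cong_AE)
    show "AE x in lebesgue. f x * exp (- \<i> * of_real (x \<bullet> \<xi>)) = g x * exp (- \<i> * of_real (x \<bullet> \<xi>))"
      using assms(3) by eventually_elim simp
  qed (intro borel_measurable_times assms lebesgue_measurable_character)+
  then show ?thesis unfolding fourier_integral_def by simp
qed

lemma fourier_integral_plancherel_le:
  fixes f :: "real ^ 'n \<Rightarrow> complex"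
  assumes f: "f \<in> L2" and int: "integrable lebesgue f"
  shows "fourier_integral f \<in> L2" "L2_norm (fourier_integral f) \<le> L2_norm f"
proof -
  obtain f' where f': "f' \<in> borel_measurable lborel" and ae: "AE x in lebesgue. f x = f' x"
    using lebesgue_measurable_complex_ex_borel[OF L2_measurable[OF f]] .
  note f'_leb = measurable_completion[OF f']
  have [measurable]: "f' \<in> borel_measurable borel" using f' by simp
  have eq: "fourier_integral f = fourier_integral f'"
    by (rule fourier_integral_cong_AE[OF L2_measurable[OF f] f'_leb ae])
  have "integrable lebesgue f'"
    using int ae integrable_cong_AE[OF L2_measurable[OF f] f'_leb] by blast
  then have int': "integrable lborel f'"
    using f' by (simp add: integrable_completion)
  define F where "F \<xi> = (\<integral>x. f' x * exp (- \<i> * of_real (x \<bullet> \<xi>)) \<partial>lborel)" for \<xi> :: "real ^ 'n"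
  have [measurable]: "F \<in> borel_measurable borel"
    unfolding F_def[abs_def] by measurable
  define c where "c = (2 * pi) powr (- real CARD('n) / 2)"
  have "0 \<le> c" by (simp add: c_def)
  \<comment> \<open>The normalisation of the transform is the one for which the constant
    \<open>(2 * pi) ^ CARD('n)\<close> becomes \<open>1\<close>.\<close>
  have c2: "c\<^sup>2 * (2 * pi) ^ CARD('n) = 1"
  proof -
    have "c\<^sup>2 = (2 * pi) powr - real CARD('n)"
      unfolding c_def power2_eq_square powr_add[symmetric] by simp
    moreover have "(2 * pi) ^ CARD('n) = (2 * pi) powr real CARD('n)"
      by (rule powr_realpow[symmetric]) simp
    ultimately show ?thesis
      by (simp only: powr_add[symmetric]) simp
  qed
  have F: "fourier_integral f \<xi> = of_real c * F \<xi>" for \<xi>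
    unfolding eq fourier_integral_def F_def c_def
    by (subst integral_completion) auto
  have "(\<integral>\<^sup>+ \<xi>. ennreal ((cmod (fourier_integral f \<xi>))\<^sup>2) \<partial>lebesgue) = (\<integral>\<^sup>+ \<xi>. ennreal (c\<^sup>2) * ennreal ((cmod (F \<xi>))\<^sup>2) \<partial>lborel)"
    by (simp add: F nn_integral_completion norm_mult power_mult_distrib ennreal_mult)
  also have "\<dots> = ennreal (c\<^sup>2) * (\<integral>\<^sup>+ \<xi>. ennreal ((cmod (F \<xi>))\<^sup>2) \<partial>lborel)"
    by (rule nn_integral_cmult) measurable
  also have "\<dots> \<le> ennreal (c\<^sup>2) * (ennreal ((2 * pi) ^ CARD('n)) * (\<integral>\<^sup>+ x. ennreal ((cmod (f' x))\<^sup>2) \<partial>lborel))"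
    using plancherel_le_lborel[OF int'] by (intro mult_left_mono) (simp_all add: F_def)
  also have "\<dots> = ennreal (c\<^sup>2 * (2 * pi) ^ CARD('n)) * (\<integral>\<^sup>+ x. ennreal ((cmod (f' x))\<^sup>2) \<partial>lborel)"
    by (subst ennreal_mult) (auto simp: mult.assoc)
  also have "\<dots> = (\<integral>\<^sup>+ x. ennreal ((cmod (f' x))\<^sup>2) \<partial>lebesgue)"
    by (simp only: c2 ennreal_1 mult_1 nn_integral_completion)
  also have "\<dots> = (\<integral>\<^sup>+ x. ennreal ((cmod (f x))\<^sup>2) \<partial>lebesgue)"
    by (rule nn_integral_cong_AE) (use ae in auto)
  also have "\<dots> = ennreal ((L2_norm f)\<^sup>2)"
    by (rule nn_integral_L2[OF f])
  finally have *: "(\<integral>\<^sup>+ \<xi>. ennreal ((cmod (fourier_integral f \<xi>))\<^sup>2) \<partial>lebesgue) \<le> ennreal ((L2_norm f)\<^sup>2)" .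
  have "fourier_integral f \<in> borel_measurable lebesgue"
    unfolding F[abs_def] by (rule measurable_completion) measurable
  with * show "fourier_integral f \<in> L2"
    by (auto simp: L2_iff_nn_integral intro: le_less_trans)
  then show "L2_norm (fourier_integral f) \<le> L2_norm f"
    using * L2_norm_nonneg by (rule L2_norm_le_of_nn_integral)
qed

definition truncation :: "(real ^ 'n \<Rightarrow> complex) \<Rightarrow> real \<Rightarrow> real ^ 'n \<Rightarrow> complex" where
  "truncation f R = (\<lambda>x. indicator (cball 0 R) x * f x)"

lemma truncation_measurable:
  "f \<in> borel_measurable lebesgue \<Longrightarrow> truncation f R \<in> borel_measurable lebesgue"
  unfolding truncation_def by (intro borel_measurable_times borel_measurable_indicator) auto

lemma truncation_L2: "f \<in> L2 \<Longrightarrow> truncation f R \<in> L2"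
  by (rule L2_cmult_bound(1)[OF truncation_measurable[OF L2_measurable], of f f 1 R])
     (auto simp: truncation_def indicator_def)

text \<open>A ball has finite measure, and on it \<open>t \<le> 1 + t\<^sup>2\<close> bounds the
  modulus by an integrable function.\<close>

lemma truncation_integrable:
  fixes f :: "real ^ 'n \<Rightarrow> complex"
  assumes "f \<in> L2"
  shows "integrable lebesgue (truncation f R)"
proof (rule Bochner_Integration.integrable_bound)
  have "emeasure lebesgue (cball (0 :: real ^ 'n) R) < \<infinity>"
    using emeasure_lborel_cball_finite[of 0 R] by (simp add: emeasure_completion)
  then show "integrable lebesgue (\<lambda>x :: real ^ 'n. indicat_real (cball 0 R) x + (cmod (f x))\<^sup>2)"
    using assms by (intro Bochner_Integration.integrable_add) (auto simp: L2_def integrable_indicator_iff)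
  show "truncation f R \<in> borel_measurable lebesgue"
    using assms by (intro truncation_measurable L2_measurable)
  have "t \<le> 1 + t\<^sup>2" for t :: real
    using zero_le_power2[of "t - 1 / 2"] by (simp add: power2_eq_square algebra_simps)
  then show "AE x in lebesgue. norm (truncation f R x) \<le> norm (indicat_real (cball 0 R) x + (cmod (f x))\<^sup>2)"
    by (intro AE_I2) (auto simp: truncation_def indicator_def)
qed

text \<open>At each point the truncation is exact once \<open>R\<close> reaches
  \<open>norm x\<close>, and the error is dominated by \<open>f\<close>.\<close>

lemma truncation_tendsto:
  fixes f :: "real ^ 'n \<Rightarrow> complex"
  assumes f: "f \<in> L2"
  shows "((\<lambda>R. L2_norm (\<lambda>x. truncation f R x - f x)) \<longlongrightarrow> 0) at_top"
proof -
  have "((\<lambda>R. LINT x|lebesgue. (cmod (truncation f R x - f x))\<^sup>2) \<longlongrightarrow> (LINT x|(lebesgue :: (real ^ 'n) measure). 0)) at_top"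
  proof (rule integral_dominated_convergence_at_top)
    show "integrable lebesgue (\<lambda>x. (cmod (f x))\<^sup>2)"
      using f by (simp add: L2_def)
    show "(\<lambda>x. (cmod (truncation f R x - f x))\<^sup>2) \<in> borel_measurable lebesgue" for R
    proof -
      note [measurable] = L2_measurable[OF f] truncation_measurable[OF L2_measurable[OF f]]
      show ?thesis by measurable
    qed
    show "\<forall>\<^sub>F R in at_top. AE x in lebesgue. norm ((cmod (truncation f R x - f x))\<^sup>2) \<le> (cmod (f x))\<^sup>2"
      by (intro always_eventually allI AE_I2) (simp add: truncation_def indicator_def)
    show "AE x in lebesgue. ((\<lambda>R. (cmod (truncation f R x - f x))\<^sup>2) \<longlongrightarrow> 0) at_top"
    proof (intro AE_I2 tendsto_eventually)
      fix x :: "real ^ 'n"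
      show "\<forall>\<^sub>F R in at_top. (cmod (truncation f R x - f x))\<^sup>2 = 0"
        using eventually_ge_at_top[of "norm x"]
        by eventually_elim (simp add: truncation_def indicator_def)
    qed
  qed simp
  then have "((\<lambda>R. sqrt (LINT x|lebesgue. (cmod (truncation f R x - f x))\<^sup>2)) \<longlongrightarrow> sqrt 0) at_top"
    by (intro tendsto_intros) simp
  then show ?thesis by (simp add: L2_norm_def)
qed

lemma fourier_integral_diff:
  assumes f: "integrable lebesgue f" and g: "integrable lebesgue g"
  shows "fourier_integral (\<lambda>x. f x - g x) \<xi> = fourier_integral f \<xi> - fourier_integral g \<xi>"
proof -
  have "integrable lebesgue (\<lambda>x. h x * exp (- \<i> * of_real (x \<bullet> \<xi>)))" if h: "integrable lebesgue h" for h
  proof (rule Bochner_Integration.integrable_bound[OF h])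
    show "(\<lambda>x. h x * exp (- \<i> * of_real (x \<bullet> \<xi>))) \<in> borel_measurable lebesgue"
      using h by (intro borel_measurable_times lebesgue_measurable_character borel_measurable_integrable)
  qed (simp add: norm_mult)
  then show ?thesis
    using assms by (simp add: fourier_integral_def left_diff_distrib right_diff_distrib)
qed

lemma fourier_integral_truncation_L2: "f \<in> L2 \<Longrightarrow> fourier_integral (truncation f R) \<in> L2"
  by (intro fourier_integral_plancherel_le truncation_L2 truncation_integrable)

section \<open>Existence and properties of the transform as a limit\<close>

definition fourier_limit :: "(real ^ 'n \<Rightarrow> complex) \<Rightarrow> (real ^ 'n \<Rightarrow> complex) \<Rightarrow> bool" where
  "fourier_limit f F \<longleftrightarrow> F \<in> L2 \<and>
     ((\<lambda>R. L2_norm (\<lambda>\<xi>. fourier_integral (truncation f R) \<xi> - F \<xi>)) \<longlongrightarrow> 0) at_top"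

text \<open>Transforms of truncations of \<open>f\<close> lie in \<open>L2\<close>, so the
  nonnegative integrals in the definition are squares of norms. The two conditions agree for every
  candidate \<open>F\<close>, and \<open>SOME\<close> is applied to the same predicate.\<close>

lemma fourier_altdef:
  assumes f: "f \<in> L2"
  shows "fourier f = (SOME F. fourier_limit f F)"
proof -
  have "((\<lambda>R. \<integral>\<^sup>+ \<xi>. ennreal ((cmod (fourier_integral (truncation f R) \<xi> - F \<xi>))\<^sup>2) \<partial>lebesgue) \<longlongrightarrow> 0) at_top
      \<longleftrightarrow> ((\<lambda>R. L2_norm (\<lambda>\<xi>. fourier_integral (truncation f R) \<xi> - F \<xi>)) \<longlongrightarrow> 0) at_top" (is "?l \<longleftrightarrow> ?r")
    if F: "F \<in> L2" for F
  proof -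
    let ?N = "\<lambda>R. L2_norm (\<lambda>\<xi>. fourier_integral (truncation f R) \<xi> - F \<xi>)"
    have "?l \<longleftrightarrow> ((\<lambda>R. ennreal ((?N R)\<^sup>2)) \<longlongrightarrow> ennreal 0) at_top"
      using F f by (simp add: nn_integral_L2 L2_minus fourier_integral_truncation_L2)
    also have "\<dots> \<longleftrightarrow> ((\<lambda>R. (?N R)\<^sup>2) \<longlongrightarrow> 0) at_top"
      by (rule tendsto_ennreal_iff) auto
    also have "\<dots> \<longleftrightarrow> ?r"
      using tendsto_power[of ?N 0 at_top 2] tendsto_real_sqrt[of "\<lambda>R. (?N R)\<^sup>2" 0 at_top]
      by (auto simp: L2_norm_nonneg)
    finally show ?thesis .
  qed
  then show ?thesis
    unfolding fourier_def fourier_limit_def truncation_def by (metis (mono_tags, lifting))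
qed

text \<open>Plancherel's inequality, applied to differences of truncations, makes their transforms a
  Cauchy family. Completeness concerns sequences, so the limit is found along integer radii and then
  extended to real ones.\<close>

lemma fourier_limit_ex:
  assumes f: "f \<in> L2"
  shows "\<exists>F. fourier_limit f F"
proof -
  let ?F = "\<lambda>R. fourier_integral (truncation f R)"
  define a where "a R = L2_norm (\<lambda>x. truncation f R x - f x)" for R
  have le: "L2_norm (\<lambda>\<xi>. ?F R \<xi> - ?F S \<xi>) \<le> a R + a S" for R S
  proof -
    let ?d = "\<lambda>x. truncation f R x - truncation f S x"
    have "fourier_integral ?d = (\<lambda>\<xi>. ?F R \<xi> - ?F S \<xi>)"
      using f by (intro ext fourier_integral_diff truncation_integrable)
    then have "L2_norm (\<lambda>\<xi>. ?F R \<xi> - ?F S \<xi>) = L2_norm (fourier_integral ?d)"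
      by simp
    also have "\<dots> \<le> L2_norm ?d"
      using f by (intro fourier_integral_plancherel_le L2_minus Bochner_Integration.integrable_diff truncation_L2 truncation_integrable)
    also have "\<dots> \<le> a R + L2_norm (\<lambda>x. f x - truncation f S x)"
      unfolding a_def using f by (intro L2_norm_triangle truncation_L2)
    also have "L2_norm (\<lambda>x. f x - truncation f S x) = a S"
      unfolding a_def by (rule L2_norm_minus_commute)
    finally show ?thesis .
  qed
  have a: "(a \<longlongrightarrow> 0) at_top"
    unfolding a_def[abs_def] by (rule truncation_tendsto[OF f])
  have a_small: "\<exists>N. \<forall>R\<ge>N. a R < e" if "0 < e" for e
    using order_tendstoD(2)[OF a that] by (simp add: eventually_at_top_linorder)
  have "\<exists>F\<in>L2. (\<lambda>n. L2_norm (\<lambda>\<xi>. ?F (real n) \<xi> - F \<xi>)) \<longlonglongrightarrow> 0"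
  proof (rule L2_complete)
    show "?F (real n) \<in> L2" for n
      using f by (rule fourier_integral_truncation_L2)
    fix e :: real assume "0 < e"
    then obtain N where N: "\<And>R. N \<le> R \<Longrightarrow> a R < e / 2"
      using a_small[of "e / 2"] by auto
    have "L2_norm (\<lambda>\<xi>. ?F (real m) \<xi> - ?F (real n) \<xi>) < e" if "nat \<lceil>N\<rceil> \<le> m" "nat \<lceil>N\<rceil> \<le> n" for m n
      using le[of "real m" "real n"] N[of "real m"] N[of "real n"] that by linarith
    then show "\<exists>N. \<forall>m\<ge>N. \<forall>n\<ge>N. L2_norm (\<lambda>\<xi>. ?F (real m) \<xi> - ?F (real n) \<xi>) < e" by blast
  qed
  then obtain F where F: "F \<in> L2" and lim: "(\<lambda>n. L2_norm (\<lambda>\<xi>. ?F (real n) \<xi> - F \<xi>)) \<longlonglongrightarrow> 0" by blast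
  have a_nat: "(\<lambda>n. a (real n)) \<longlonglongrightarrow> 0"
    by (rule filterlim_compose[OF a filterlim_real_sequentially])
  \<comment> \<open>Compare the radius \<open>R\<close> with the integer radius \<open>n\<close> and
    let \<open>n\<close> tend to infinity: only \<open>a R\<close> remains.\<close>
  have "L2_norm (\<lambda>\<xi>. ?F R \<xi> - F \<xi>) \<le> a R" for R
  proof (rule tendsto_lowerbound)
    show "(\<lambda>n. a R + a (real n) + L2_norm (\<lambda>\<xi>. ?F (real n) \<xi> - F \<xi>)) \<longlonglongrightarrow> a R"
      using tendsto_add[OF tendsto_add[OF tendsto_const[of "a R"] a_nat] lim] by simp
    show "\<forall>\<^sub>F n in sequentially. L2_norm (\<lambda>\<xi>. ?F R \<xi> - F \<xi>) \<le> a R + a (real n) + L2_norm (\<lambda>\<xi>. ?F (real n) \<xi> - F \<xi>)"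
    proof (intro always_eventually allI)
      fix n
      have "L2_norm (\<lambda>\<xi>. ?F R \<xi> - F \<xi>) \<le> L2_norm (\<lambda>\<xi>. ?F R \<xi> - ?F (real n) \<xi>) + L2_norm (\<lambda>\<xi>. ?F (real n) \<xi> - F \<xi>)"
        using f F by (intro L2_norm_triangle fourier_integral_truncation_L2)
      with le[of R "real n"] show "L2_norm (\<lambda>\<xi>. ?F R \<xi> - F \<xi>) \<le> a R + a (real n) + L2_norm (\<lambda>\<xi>. ?F (real n) \<xi> - F \<xi>)" by simp
    qed
  qed simp
  then have "((\<lambda>R. L2_norm (\<lambda>\<xi>. ?F R \<xi> - F \<xi>)) \<longlongrightarrow> 0) at_top"
    by (intro tendsto_sandwich[OF _ _ tendsto_const a]) (auto simp: L2_norm_nonneg)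
  with F show ?thesis by (auto simp: fourier_limit_def)
qed

lemma fourier_limit_fourier: "f \<in> L2 \<Longrightarrow> fourier_limit f (fourier f)"
  unfolding fourier_altdef by (rule someI_ex[OF fourier_limit_ex])

lemma fourier_L2: "f \<in> L2 \<Longrightarrow> fourier f \<in> L2"
  using fourier_limit_fourier by (auto simp: fourier_limit_def)

lemma fourier_plancherel_le:
  assumes f: "f \<in> L2"
  shows "L2_norm (fourier f) \<le> L2_norm f"
proof (rule tendsto_lowerbound)
  let ?F = "\<lambda>R. fourier_integral (truncation f R)"
  have "((\<lambda>R. L2_norm (\<lambda>\<xi>. ?F R \<xi> - fourier f \<xi>)) \<longlongrightarrow> 0) at_top"
    using fourier_limit_fourier[OF f] by (simp add: fourier_limit_def)
  from tendsto_add[OF tendsto_const[of "L2_norm f"] this]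
  show "((\<lambda>R. L2_norm f + L2_norm (\<lambda>\<xi>. ?F R \<xi> - fourier f \<xi>)) \<longlongrightarrow> L2_norm f) at_top" by simp
  show "\<forall>\<^sub>F R in at_top. L2_norm (fourier f) \<le> L2_norm f + L2_norm (\<lambda>\<xi>. ?F R \<xi> - fourier f \<xi>)"
  proof (intro always_eventually allI)
    fix R
    have F: "?F R \<in> L2" "fourier f \<in> L2"
      using f by (auto intro: fourier_integral_truncation_L2 fourier_L2)
    have "L2_norm (fourier f) = L2_norm (\<lambda>\<xi>. ?F R \<xi> - (?F R \<xi> - fourier f \<xi>))" by simp
    also have "\<dots> \<le> L2_norm (?F R) + L2_norm (\<lambda>\<xi>. ?F R \<xi> - fourier f \<xi>)"
      by (intro L2_minus F)
    also have "L2_norm (?F R) \<le> L2_norm (truncation f R)"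
      using f by (intro fourier_integral_plancherel_le truncation_L2 truncation_integrable)
    also have "L2_norm (truncation f R) \<le> 1 * L2_norm f"
      by (rule L2_cmult_bound(2)[OF truncation_measurable[OF L2_measurable[OF f]] f])
         (auto simp: truncation_def indicator_def)
    finally show "L2_norm (fourier f) \<le> L2_norm f + L2_norm (\<lambda>\<xi>. ?F R \<xi> - fourier f \<xi>)" by simp
  qed
qed simp

text \<open>\<open>fourier\<close> picks its limit separately for each function, so linearity is
  asserted only up to null sets. The norm of the defect does not depend on \<open>R\<close>, but it
  is bounded by three approximation errors that vanish as \<open>R\<close> grows.\<close>

lemma fourier_diff:
  fixes f g :: "real ^ 'n \<Rightarrow> complex"
  assumes f: "f \<in> L2" and g: "g \<in> L2"
  shows "AE \<xi> in lebesgue. fourier (\<lambda>x. f x - g x) \<xi> = fourier f \<xi> - fourier g \<xi>"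
proof -
  let ?h = "\<lambda>x. f x - g x"
  have h: "?h \<in> L2" by (rule L2_minus(1)[OF f g])
  let ?T = "\<lambda>u R. fourier_integral (truncation u R)"
  let ?e = "\<lambda>u R \<xi>. ?T u R \<xi> - fourier u \<xi>"
  have e: "?e u R \<in> L2" if "u \<in> L2" for u :: "real ^ 'n \<Rightarrow> complex" and R
    using that by (intro L2_minus fourier_integral_truncation_L2 fourier_L2)
  let ?D = "\<lambda>\<xi>. fourier ?h \<xi> - (fourier f \<xi> - fourier g \<xi>)"
  have D: "?D \<in> L2"
    using f g h by (intro L2_minus fourier_L2)
  have le: "L2_norm ?D \<le> L2_norm (?e f R) + L2_norm (?e g R) + L2_norm (?e ?h R)" for R
  proof -
    have "truncation ?h R = (\<lambda>x. truncation f R x - truncation g R x)"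
      by (auto simp: truncation_def algebra_simps)
    then have "?T ?h R \<xi> = ?T f R \<xi> - ?T g R \<xi>" for \<xi>
      using f g by (simp add: fourier_integral_diff truncation_integrable)
    then have "?D = (\<lambda>\<xi>. (?e f R \<xi> - ?e g R \<xi>) - ?e ?h R \<xi>)"
      by (auto simp: algebra_simps)
    then have "L2_norm ?D \<le> L2_norm (\<lambda>\<xi>. ?e f R \<xi> - ?e g R \<xi>) + L2_norm (?e ?h R)"
      using f g h by (simp only:) (intro L2_minus e)
    also have "L2_norm (\<lambda>\<xi>. ?e f R \<xi> - ?e g R \<xi>) \<le> L2_norm (?e f R) + L2_norm (?e g R)"
      using f g by (intro L2_minus e)
    finally show ?thesis by simp
  qed
  have lim: "((\<lambda>R. L2_norm (?e u R)) \<longlongrightarrow> 0) at_top" if "u \<in> L2" for u :: "real ^ 'n \<Rightarrow> complex"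
    using fourier_limit_fourier[OF that] by (simp add: fourier_limit_def)
  have "L2_norm ?D \<le> 0 + 0 + 0"
  proof (rule tendsto_lowerbound)
    show "((\<lambda>R. L2_norm (?e f R) + L2_norm (?e g R) + L2_norm (?e ?h R)) \<longlongrightarrow> 0 + 0 + 0) at_top"
      by (intro tendsto_add lim f g h)
  qed (use le in auto)
  then have "L2_norm ?D = 0"
    using L2_norm_nonneg[of ?D] by simp
  from L2_norm_eq_0[OF D this] show ?thesis
    by eventually_elim simp
qed

text \<open>Equality holds at every point: the Fourier integrals of the truncations coincide, so
  \<open>SOME\<close> chooses from the same predicate for both functions.\<close>

lemma fourier_cong_AE:
  assumes "f \<in> borel_measurable lebesgue" "g \<in> borel_measurable lebesgue" "AE x in lebesgue. f x = g x"
  shows "fourier f = fourier g"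
proof -
  have "fourier_integral (truncation f R) = fourier_integral (truncation g R)" for R
    using assms by (intro fourier_integral_cong_AE truncation_measurable) (auto simp: truncation_def)
  then show ?thesis
    unfolding fourier_def truncation_def by simp
qed

section \<open>Estimates in frequency space\<close>

lemma mittag_leffler_two_sided:
  assumes \<gamma>: "0 < \<gamma>" "\<gamma> < 1"
  obtains c C where "0 < c" "0 < C"
    "\<And>x. 0 \<le> x \<Longrightarrow> c / (1 + x) \<le> mittag_leffler \<gamma> 1 (- x)"
    "\<And>x. 0 \<le> x \<Longrightarrow> mittag_leffler \<gamma> 1 (- x) \<le> C / (1 + x)"
proof (rule that)
  define a b where "a = 1 / Gamma (1 - \<gamma>)" and "b = Gamma (\<gamma> + 1)"
  have ab: "0 < a" "0 < b" using \<gamma> by (auto simp: a_def b_def Gamma_real_pos)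
  \<comment> \<open>\<open>min 1 a\<close> and \<open>max 1 b\<close> bring the two differently
    scaled bounds to the common form \<open>1 / (1 + x)\<close>.\<close>
  show "0 < min 1 a" "0 < max 1 b" using ab by auto
  fix x :: real assume x: "0 \<le> x"
  define E where "E = mittag_leffler \<gamma> 1 (- x)"
  have up: "E * (1 + x / b) \<le> 1" and lo: "a \<le> E * (x + a)"
    using mittag_leffler_bounds[OF \<gamma> x] by (simp_all add: E_def a_def b_def)
  \<comment> \<open>The lower bound comes first, because it supplies the sign of \<open>E\<close>
    with which the upper bound is rearranged.\<close>
  have "0 < a / (x + a)" using ab x by simp
  also have "a / (x + a) \<le> E"
    using lo ab x by (simp add: pos_divide_le_eq)
  finally have "0 < E" .
  have "min 1 a * (x + a) \<le> a * (1 + x)"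
  proof -
    have "min 1 a * x + min 1 a * a \<le> a * x + 1 * a"
      using ab x by (intro add_mono mult_right_mono) auto
    then show ?thesis by (simp add: algebra_simps)
  qed
  then have "min 1 a / (1 + x) \<le> a / (x + a)"
    using ab x by (simp add: divide_simps)
  with \<open>a / (x + a) \<le> E\<close> show "min 1 a / (1 + x) \<le> mittag_leffler \<gamma> 1 (- x)"
    by (simp add: E_def)
  have "1 + x \<le> max 1 b * (1 + x / b)"
  proof -
    have "1 * 1 + b * (x / b) \<le> max 1 b * 1 + max 1 b * (x / b)"
      using ab x by (intro add_mono mult_right_mono) auto
    then show ?thesis using ab by (simp add: distrib_left)
  qed
  then have "E * (1 + x) \<le> E * (max 1 b * (1 + x / b))"
    using \<open>0 < E\<close> by (intro mult_left_mono) auto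
  also have "\<dots> = max 1 b * (E * (1 + x / b))"
    by (rule mult.left_commute)
  also have "\<dots> \<le> max 1 b * 1"
    using up by (intro mult_left_mono) auto
  finally show "mittag_leffler \<gamma> 1 (- x) \<le> max 1 b / (1 + x)"
    using x by (simp add: E_def pos_le_divide_eq)
qed

lemma propagator_pos:
  assumes "0 < \<gamma>" "\<gamma> < 1"
  shows "0 < propagator \<gamma> t \<xi>"
proof -
  obtain c where "0 < c" and lo: "\<And>x. 0 \<le> x \<Longrightarrow> c / (1 + x) \<le> mittag_leffler \<gamma> 1 (- x)"
    using mittag_leffler_two_sided[OF assms] by metis
  have "0 < c / (1 + (norm \<xi>)\<^sup>2 * t powr \<gamma>)"
    using \<open>0 < c\<close> by (intro divide_pos_pos add_pos_nonneg) auto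
  also have "\<dots> \<le> propagator \<gamma> t \<xi>"
    unfolding propagator_def by (rule lo) simp
  finally show ?thesis .
qed

text \<open>With \<open>x = (norm \<xi>)\<^sup>2\<close> the quotient is, up to constants,
  \<open>(1 + x * T powr \<gamma>) / (1 + x * t powr \<gamma>)\<close>. This is nondecreasing in
  \<open>x\<close> for \<open>t \<le> T\<close> and tends to
  \<open>T powr \<gamma> / t powr \<gamma>\<close>, the source of the singular factor in
  time.\<close>

lemma propagator_ratio_bound:
  assumes \<gamma>: "0 < \<gamma>" "\<gamma> < 1" and "0 < T"
  obtains \<kappa> where "0 < \<kappa>"
    "\<And>t (\<xi> :: real ^ 'n). 0 < t \<Longrightarrow> t \<le> T \<Longrightarrow> propagator \<gamma> t \<xi> / propagator \<gamma> T \<xi> \<le> \<kappa> / t powr \<gamma>"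
proof -
  obtain c C where cC: "0 < c" "0 < C"
    and lo: "\<And>x. 0 \<le> x \<Longrightarrow> c / (1 + x) \<le> mittag_leffler \<gamma> 1 (- x)"
    and up: "\<And>x. 0 \<le> x \<Longrightarrow> mittag_leffler \<gamma> 1 (- x) \<le> C / (1 + x)"
    using mittag_leffler_two_sided[OF \<gamma>] by metis
  show thesis
  proof (rule that)
    show "0 < C * T powr \<gamma> / c" using cC \<open>0 < T\<close> by simp
    fix t and \<xi> :: "real ^ 'n" assume t: "0 < t" "t \<le> T"
    define x where "x = (norm \<xi>)\<^sup>2"
    have "0 \<le> x" by (simp add: x_def)
    have tT: "0 < t powr \<gamma>" "t powr \<gamma> \<le> T powr \<gamma>" "0 < T powr \<gamma>"
      using t \<gamma> by (auto intro: powr_mono2)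
    have pos: "0 < 1 + x * t powr \<gamma>" "0 < 1 + x * T powr \<gamma>"
      using \<open>0 \<le> x\<close> by (auto intro: add_pos_nonneg)
    have "propagator \<gamma> t \<xi> / propagator \<gamma> T \<xi> \<le> (C / (1 + x * t powr \<gamma>)) / (c / (1 + x * T powr \<gamma>))"
      unfolding propagator_def x_def[symmetric]
      using lo[of "x * T powr \<gamma>"] up[of "x * t powr \<gamma>"] cC pos \<open>0 \<le> x\<close>
      by (intro frac_le) auto
    also have "\<dots> = C / c * ((1 + x * T powr \<gamma>) / (1 + x * t powr \<gamma>))"
      using cC pos by (simp add: field_simps)
    also have "\<dots> \<le> C / c * (T powr \<gamma> / t powr \<gamma>)"
    proof (intro mult_left_mono)
      have "(1 + x * T powr \<gamma>) * t powr \<gamma> \<le> T powr \<gamma> * (1 + x * t powr \<gamma>)"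
        using tT by (simp add: algebra_simps)
      then show "(1 + x * T powr \<gamma>) / (1 + x * t powr \<gamma>) \<le> T powr \<gamma> / t powr \<gamma>"
        using tT pos by (simp add: divide_le_eq le_divide_eq)
    qed (use cC in auto)
    finally show "propagator \<gamma> t \<xi> / propagator \<gamma> T \<xi> \<le> C * T powr \<gamma> / c / t powr \<gamma>"
      by simp
  qed
qed

text \<open>Evolution up to time \<open>T\<close> gains two derivatives. The factor
  \<open>1 + 1 / R\<close> compares \<open>1 + x\<close> with \<open>1 + x * R\<close> for small and
  large \<open>R\<close> alike.\<close>

lemma propagator_smoothing:
  assumes \<gamma>: "0 < \<gamma>" "\<gamma> < 1" and "0 < T"
  obtains K where "0 < K" "\<And>\<xi> :: real ^ 'n. (1 + (norm \<xi>)\<^sup>2) * propagator \<gamma> T \<xi> \<le> K"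
proof -
  obtain C where "0 < C" and up: "\<And>x. 0 \<le> x \<Longrightarrow> mittag_leffler \<gamma> 1 (- x) \<le> C / (1 + x)"
    using mittag_leffler_two_sided[OF \<gamma>] by metis
  define R where "R = T powr \<gamma>"
  have "0 < R" using \<open>0 < T\<close> by (simp add: R_def)
  show thesis
  proof (rule that)
    show "0 < (1 + 1 / R) * C" using \<open>0 < C\<close> \<open>0 < R\<close> by (simp add: add_pos_pos)
    fix \<xi> :: "real ^ 'n"
    define x where "x = (norm \<xi>)\<^sup>2"
    have "0 \<le> x" by (simp add: x_def)
    have pos: "0 < 1 + x * R" using \<open>0 \<le> x\<close> \<open>0 < R\<close> by (intro add_pos_nonneg) auto
    have "(1 + x) * propagator \<gamma> T \<xi> \<le> ((1 + 1 / R) * (1 + x * R)) * (C / (1 + x * R))"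
    proof (intro mult_mono)
      show "1 + x \<le> (1 + 1 / R) * (1 + x * R)"
        using \<open>0 \<le> x\<close> \<open>0 < R\<close> by (simp add: field_simps)
      show "propagator \<gamma> T \<xi> \<le> C / (1 + x * R)"
        unfolding propagator_def x_def[symmetric] R_def[symmetric]
        using \<open>0 \<le> x\<close> \<open>0 < R\<close> by (intro up) auto
      show "0 \<le> (1 + 1 / R) * (1 + x * R)" using pos \<open>0 < R\<close> by simp
    qed (simp add: propagator_pos[OF \<gamma>] less_imp_le)
    also have "\<dots> = (1 + 1 / R) * C" using pos by simp
    finally show "(1 + (norm \<xi>)\<^sup>2) * propagator \<gamma> T \<xi> \<le> (1 + 1 / R) * C"
      by (simp add: x_def)
  qed
qed

section \<open>Bounds for the regularizing filter\<close>

lemma power2_powr_half: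
  fixes x a :: real
  assumes "0 \<le> x"
  shows "(x\<^sup>2) powr (a / 2) = x powr a"
proof (cases "x = 0")
  case False
  then have "x\<^sup>2 = x powr 2" using assms by simp
  then show ?thesis by (simp only: powr_powr) simp
qed simp

lemma regularizing_filter_range:
  assumes "0 \<le> \<tau>"
  shows "0 < regularizing_filter \<tau> s \<alpha> \<xi>" "regularizing_filter \<tau> s \<alpha> \<xi> \<le> 1"
  using assms by (auto simp: regularizing_filter_def)

text \<open>The bias of the filter. With \<open>y = \<alpha> * norm \<xi>\<close> it is at most
  \<open>1\<close> and at most \<open>\<tau> * y powr s\<close>; the first bound serves for
  \<open>y > 1\<close>, the second for \<open>y \<le> 1\<close>, where \<open>q \<le> s\<close>
  lowers the exponent.\<close>

lemma one_minus_regularizing_filter_le: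
  assumes "0 \<le> \<tau>" "0 \<le> q" "q \<le> s" "0 < \<alpha>"
  shows "1 - regularizing_filter \<tau> s \<alpha> \<xi> \<le> (1 + \<tau>) * \<alpha> powr q * (1 + (norm \<xi>)\<^sup>2) powr (q / 2)"
proof -
  define y where "y = \<alpha> * norm \<xi>"
  have "0 \<le> y" using assms by (simp add: y_def)
  have "1 - regularizing_filter \<tau> s \<alpha> \<xi> \<le> (1 + \<tau>) * y powr q" if "norm \<xi> \<noteq> 0"
  proof (cases "y \<le> 1")
    case True
    have "1 - regularizing_filter \<tau> s \<alpha> \<xi> \<le> \<tau> * y powr s"
      using exp_ge_add_one_self[of "- \<tau> * y powr s"] by (simp add: regularizing_filter_def y_def)
    also have "\<dots> \<le> (1 + \<tau>) * y powr q"
    proof (intro mult_mono)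
      show "y powr s \<le> y powr q"
        using True \<open>0 \<le> y\<close> assms by (intro powr_mono') auto
    qed (use assms in auto)
    finally show ?thesis .
  next
    case False
    have "1 - regularizing_filter \<tau> s \<alpha> \<xi> \<le> 1 * 1"
      using regularizing_filter_range(1)[OF assms(1), of s \<alpha> \<xi>] by simp
    also have "\<dots> \<le> (1 + \<tau>) * y powr q"
      using False assms by (intro mult_mono ge_one_powr_ge_zero) auto
    finally show ?thesis .
  qed
  moreover have "regularizing_filter \<tau> s \<alpha> \<xi> = 1" if "norm \<xi> = 0"
    using that by (simp add: regularizing_filter_def)
  ultimately have "1 - regularizing_filter \<tau> s \<alpha> \<xi> \<le> (1 + \<tau>) * y powr q"
    using assms by fastforce
  also have "y powr q = \<alpha> powr q * norm \<xi> powr q"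
    using assms by (simp add: y_def powr_mult)
  also have "norm \<xi> powr q = ((norm \<xi>)\<^sup>2) powr (q / 2)"
    by (simp add: power2_powr_half)
  also have "(1 + \<tau>) * (\<alpha> powr q * \<dots>) \<le> (1 + \<tau>) * (\<alpha> powr q * (1 + (norm \<xi>)\<^sup>2) powr (q / 2))"
    using assms by (intro mult_left_mono powr_mono2) auto
  finally show ?thesis by (simp add: mult.assoc)
qed

text \<open>The filter absorbs the weight at the price of \<open>\<alpha> powr - q\<close>. Indeed
  \<open>y powr q \<le> 1 + y powr s\<close> because \<open>q \<le> s\<close>, and
  \<open>y powr s\<close> times the filter is at most \<open>1 / \<tau>\<close>. The factor
  \<open>2 powr (q / 2)\<close> comes from splitting the weight into \<open>1\<close> and
  \<open>norm \<xi> powr q\<close>.\<close>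

lemma sobolev_weight_regularizing_filter_le:
  assumes "0 < \<tau>" "0 \<le> q" "q \<le> s" "0 < \<alpha>"
  shows "(1 + (norm \<xi>)\<^sup>2) powr (q / 2) * regularizing_filter \<tau> s \<alpha> \<xi>
    \<le> 2 powr (q / 2) * (1 + (1 + 1 / \<tau>) * \<alpha> powr - q)"
proof -
  define y where "y = \<alpha> * norm \<xi>"
  define A where "A = regularizing_filter \<tau> s \<alpha> \<xi>"
  have "0 \<le> y" using assms by (simp add: y_def)
  have A: "0 < A" "A \<le> 1"
    using assms by (auto simp: A_def regularizing_filter_range less_imp_le)
  have "y powr q \<le> 1 + y powr s"
  proof (cases "y \<le> 1")
    case True
    then have "y powr q \<le> 1" using \<open>0 \<le> y\<close> assms by (intro powr_le1) auto
    then show ?thesis by (simp add: add_increasing2)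
  next
    case False
    then have "y powr q \<le> y powr s" using assms by (intro powr_mono) auto
    then show ?thesis by simp
  qed
  then have "y powr q * A \<le> (1 + y powr s) * A"
    using A by (intro mult_right_mono) auto
  also have "\<dots> = A + y powr s * A" by (simp add: algebra_simps)
  also have "\<dots> \<le> 1 + 1 / \<tau>"
  proof (rule add_mono)
    have "\<tau> * y powr s \<le> exp (\<tau> * y powr s)"
      using exp_ge_add_one_self[of "\<tau> * y powr s"] by linarith
    then show "y powr s * A \<le> 1 / \<tau>"
      using assms by (simp add: A_def regularizing_filter_def y_def exp_minus field_simps)
  qed (use A in auto)
  finally have yA: "y powr q * A \<le> 1 + 1 / \<tau>" .
  have "(1 + (norm \<xi>)\<^sup>2) powr (q / 2) \<le> 2 powr (q / 2) * (1 + norm \<xi> powr q)"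
  proof -
    have "(1 + (norm \<xi>)\<^sup>2) powr (q / 2) \<le> (2 * max 1 ((norm \<xi>)\<^sup>2)) powr (q / 2)"
      using assms by (intro powr_mono2) auto
    also have "\<dots> = 2 powr (q / 2) * (max 1 ((norm \<xi>)\<^sup>2)) powr (q / 2)"
      by (rule powr_mult)
    also have "\<dots> \<le> 2 powr (q / 2) * (1 + norm \<xi> powr q)"
      by (intro mult_left_mono) (auto simp: max_def power2_powr_half)
    finally show ?thesis .
  qed
  then have "(1 + (norm \<xi>)\<^sup>2) powr (q / 2) * A \<le> 2 powr (q / 2) * (1 + norm \<xi> powr q) * A"
    using A by (intro mult_right_mono) auto
  also have "\<dots> = 2 powr (q / 2) * (A + norm \<xi> powr q * A)"
    by (simp add: algebra_simps)
  also have "norm \<xi> powr q = \<alpha> powr - q * y powr q"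
    using assms by (simp add: y_def powr_mult powr_minus)
  also have "2 powr (q / 2) * (A + \<alpha> powr - q * y powr q * A) \<le> 2 powr (q / 2) * (1 + \<alpha> powr - q * (1 + 1 / \<tau>))"
    unfolding mult.assoc using A yA by (intro mult_left_mono add_mono) auto
  finally show ?thesis by (simp add: A_def mult.commute)
qed

section \<open>Multipliers, interpolation and the discrepancy principle\<close>

lemma L2_multiplier_bound:
  fixes F H :: "real ^ 'n \<Rightarrow> complex"
  assumes m: "m \<in> borel_measurable borel" and F: "F \<in> L2" and H: "H \<in> L2" and "0 \<le> c"
    and le: "AE \<xi> in lebesgue. \<bar>m \<xi>\<bar> * cmod (F \<xi>) \<le> c * cmod (H \<xi>)"
  shows "(\<lambda>\<xi>. of_real (m \<xi>) * F \<xi>) \<in> L2" "L2_norm (\<lambda>\<xi>. of_real (m \<xi>) * F \<xi>) \<le> c * L2_norm H"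
proof -
  have "(\<lambda>\<xi>. complex_of_real (m \<xi>)) \<in> borel_measurable lebesgue"
    using m by (intro measurable_completion) measurable
  then have meas: "(\<lambda>\<xi>. of_real (m \<xi>) * F \<xi>) \<in> borel_measurable lebesgue"
    using L2_measurable[OF F] by (rule borel_measurable_times)
  have "AE \<xi> in lebesgue. cmod (of_real (m \<xi>) * F \<xi>) \<le> c * cmod (H \<xi>)"
    using le by (simp add: norm_mult)
  then show "(\<lambda>\<xi>. of_real (m \<xi>) * F \<xi>) \<in> L2" "L2_norm (\<lambda>\<xi>. of_real (m \<xi>) * F \<xi>) \<le> c * L2_norm H"
    by (intro L2_cmult_bound[OF meas H \<open>0 \<le> c\<close>]; assumption)+
qed

lemma regularizing_filter_measurable:
  "regularizing_filter \<tau> s \<alpha> \<in> borel_measurable borel"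
  unfolding regularizing_filter_def[abs_def] by measurable

lemma sobolev_weight_measurable:
  "(\<lambda>\<xi> :: real ^ 'n. (1 + (norm \<xi>)\<^sup>2) powr (p / 2)) \<in> borel_measurable borel"
  by measurable

text \<open>In place of Hoelder's inequality, \<open>z powr \<nu> \<le> 1 + z\<close> dominates the
  intermediate weight by a combination of \<open>1\<close> and the weight \<open>W\<close> of order
  \<open>q\<close>. Taking \<open>z = \<delta> / N * W\<close> balances the two contributions: both
  become multiples of \<open>N powr \<nu> * \<delta> powr (1 - \<nu>)\<close>.\<close>

lemma sobolev_weight_interpolation:
  fixes M :: "real ^ 'n \<Rightarrow> complex"
  assumes "0 < q" "0 \<le> l" "l \<le> q" "0 < \<delta>" "0 < N" "0 \<le> a" "0 \<le> b"
    and M: "M \<in> L2" "L2_norm M \<le> a * \<delta>"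
    and WM: "sobolev_weight q M \<in> L2" "L2_norm (sobolev_weight q M) \<le> b * N"
  shows "sobolev_weight l M \<in> L2"
    "L2_norm (sobolev_weight l M) \<le> (a + b) * N powr (l / q) * \<delta> powr (1 - l / q)"
proof -
  define \<nu> where "\<nu> = l / q"
  define \<mu> where "\<mu> = (N / \<delta>) powr \<nu>"
  have \<nu>: "0 \<le> \<nu>" "\<nu> \<le> 1" using assms by (auto simp: \<nu>_def)
  have "0 \<le> \<mu>" by (simp add: \<mu>_def)
  have weight: "(1 + (norm \<xi>)\<^sup>2) powr (l / 2) \<le> \<mu> + \<mu> * (\<delta> / N) * (1 + (norm \<xi>)\<^sup>2) powr (q / 2)" for \<xi> :: "real ^ 'n"
  proof -
    define W where "W = (1 + (norm \<xi>)\<^sup>2) powr (q / 2)"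
    have "0 \<le> W" by (simp add: W_def)
    have "(1 + (norm \<xi>)\<^sup>2) powr (l / 2) = W powr \<nu>"
      using \<open>0 < q\<close> by (simp add: W_def \<nu>_def powr_powr)
    also have "\<dots> = \<mu> * (\<delta> / N * W) powr \<nu>"
      using assms \<open>0 \<le> W\<close> by (simp add: \<mu>_def powr_mult[symmetric])
    also have "\<dots> \<le> \<mu> * (1 + \<delta> / N * W)"
    proof (rule mult_left_mono[OF _ \<open>0 \<le> \<mu>\<close>])
      let ?z = "\<delta> / N * W"
      have "0 \<le> ?z" using assms \<open>0 \<le> W\<close> by simp
      show "?z powr \<nu> \<le> 1 + ?z"
      proof (cases "?z \<le> 1")
        case True
        then have "?z powr \<nu> \<le> 1" using \<open>0 \<le> ?z\<close> \<nu> by (intro powr_le1) auto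
        then show ?thesis using \<open>0 \<le> ?z\<close> by linarith
      next
        case False
        then have "?z powr \<nu> \<le> ?z powr 1" using \<nu> by (intro powr_mono) auto
        then show ?thesis using False by simp
      qed
    qed
    finally show ?thesis by (simp add: W_def algebra_simps)
  qed
  \<comment> \<open>Taking moduli prevents cancellation, so \<open>R\<close> dominates pointwise
    while the triangle inequality still controls its norm.\<close>
  define R where "R \<xi> = of_real (\<mu> * cmod (M \<xi>)) + complex_of_real (\<mu> * (\<delta> / N) * cmod (sobolev_weight q M \<xi>))" for \<xi>
  have scaled: "(\<lambda>\<xi>. complex_of_real (c * cmod (F \<xi>))) \<in> L2"
    "L2_norm (\<lambda>\<xi>. complex_of_real (c * cmod (F \<xi>))) \<le> c * L2_norm F"
    if "F \<in> L2" "0 \<le> c" for c and F :: "real ^ 'n \<Rightarrow> complex"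
  proof -
    have "(\<lambda>\<xi>. complex_of_real (c * cmod (F \<xi>))) \<in> borel_measurable lebesgue"
      using L2_measurable[OF that(1)] by measurable
    moreover have "AE \<xi> in lebesgue. cmod (complex_of_real (c * cmod (F \<xi>))) \<le> c * cmod (F \<xi>)"
      using that by (simp add: norm_mult)
    ultimately show "(\<lambda>\<xi>. complex_of_real (c * cmod (F \<xi>))) \<in> L2"
      "L2_norm (\<lambda>\<xi>. complex_of_real (c * cmod (F \<xi>))) \<le> c * L2_norm F"
      using that by (auto intro: L2_cmult_bound)
  qed
  have "0 \<le> \<mu> * (\<delta> / N)" using \<open>0 \<le> \<mu>\<close> assms by simp
  have R: "R \<in> L2" "L2_norm R \<le> \<mu> * L2_norm M + \<mu> * (\<delta> / N) * L2_norm (sobolev_weight q M)"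
  proof -
    note 1 = scaled[OF M(1) \<open>0 \<le> \<mu>\<close>] and 2 = scaled[OF WM(1) \<open>0 \<le> \<mu> * (\<delta> / N)\<close>]
    show "R \<in> L2" unfolding R_def[abs_def] by (rule L2_add(1)[OF 1(1) 2(1)])
    show "L2_norm R \<le> \<mu> * L2_norm M + \<mu> * (\<delta> / N) * L2_norm (sobolev_weight q M)"
      unfolding R_def[abs_def] using L2_add(2)[OF 1(1) 2(1)] 1(2) 2(2) by linarith
  qed
  have "\<bar>(1 + (norm \<xi>)\<^sup>2) powr (l / 2)\<bar> * cmod (M \<xi>) \<le> 1 * cmod (R \<xi>)" for \<xi>
  proof -
    have "\<bar>(1 + (norm \<xi>)\<^sup>2) powr (l / 2)\<bar> * cmod (M \<xi>)
        \<le> (\<mu> + \<mu> * (\<delta> / N) * (1 + (norm \<xi>)\<^sup>2) powr (q / 2)) * cmod (M \<xi>)"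
      using weight[of \<xi>] by (intro mult_right_mono) auto
    also have "\<dots> = \<mu> * cmod (M \<xi>) + \<mu> * (\<delta> / N) * cmod (sobolev_weight q M \<xi>)"
      by (simp add: sobolev_weight_def norm_mult distrib_right mult.assoc)
    also have "\<dots> \<le> cmod (R \<xi>)"
      unfolding R_def of_real_add[symmetric] norm_of_real by (rule abs_ge_self)
    finally show ?thesis by simp
  qed
  then have "AE \<xi> in lebesgue. \<bar>(1 + (norm \<xi>)\<^sup>2) powr (l / 2)\<bar> * cmod (M \<xi>) \<le> 1 * cmod (R \<xi>)"
    by simp
  note bound = L2_multiplier_bound[OF sobolev_weight_measurable M(1) R(1) zero_le_one this, folded sobolev_weight_def]
  show "sobolev_weight l M \<in> L2" using bound(1) by (simp add: sobolev_weight_def[abs_def])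
  have "L2_norm (sobolev_weight l M) \<le> 1 * L2_norm R" using bound(2) by (simp add: sobolev_weight_def[abs_def])
  also have "\<dots> \<le> \<mu> * L2_norm M + \<mu> * (\<delta> / N) * L2_norm (sobolev_weight q M)" using R(2) by simp
  also have "\<dots> \<le> \<mu> * (a * \<delta>) + \<mu> * (\<delta> / N) * (b * N)"
    by (intro add_mono mult_left_mono M WM \<open>0 \<le> \<mu>\<close> \<open>0 \<le> \<mu> * (\<delta> / N)\<close>)
  also have "\<dots> = (a + b) * (\<mu> * \<delta>)"
    using \<open>0 < N\<close> by (simp add: field_simps)
  also have "\<mu> * \<delta> = N powr \<nu> * \<delta> powr (1 - \<nu>)"
    using assms by (simp add: \<mu>_def powr_divide powr_diff)
  finally show "L2_norm (sobolev_weight l M) \<le> (a + b) * N powr (l / q) * \<delta> powr (1 - l / q)"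
    by (simp add: \<nu>_def mult.assoc)
qed

text \<open>The discrepancy principle forces \<open>\<alpha>\<close> to be bounded below by a multiple of
  \<open>(\<delta> / N) powr (1 / q)\<close>, which controls the noise amplified by the weight of order \<open>q\<close>.\<close>

lemma discrepancy_principle_estimate:
  fixes G H :: "real ^ 'n \<Rightarrow> complex" and \<tau> s \<alpha> q l \<theta> \<delta> N :: real
  defines "A \<equiv> regularizing_filter \<tau> s \<alpha> :: real ^ 'n \<Rightarrow> real"
  assumes "0 < \<tau>" "0 < q" "q \<le> s" "0 \<le> l" "l \<le> q" "1 < \<theta>" "0 < \<delta>" "0 < N" "0 < \<alpha>"
    and G: "G \<in> L2" and H: "H \<in> L2" and GH: "L2_norm (\<lambda>\<xi>. G \<xi> - H \<xi>) \<le> \<delta>"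
    and WG: "sobolev_weight q G \<in> L2" "L2_norm (sobolev_weight q G) \<le> N"
    and discrepancy: "L2_norm (\<lambda>\<xi>. of_real (1 - A \<xi>) * H \<xi>) = \<theta> * \<delta>"
  defines "K \<equiv> 1 + 2 powr (q / 2) * (1 + (1 + 1 / \<tau>) * (1 + \<tau>)) / (\<theta> - 1)"
  shows "sobolev_weight l (\<lambda>\<xi>. G \<xi> - of_real (A \<xi>) * H \<xi>) \<in> L2"
    "L2_norm (sobolev_weight l (\<lambda>\<xi>. G \<xi> - of_real (A \<xi>) * H \<xi>))
      \<le> (1 + \<theta> + K) * N powr (l / q) * \<delta> powr (1 - l / q)"
proof -
  let ?w = "\<lambda>r \<xi> :: real ^ 'n. (1 + (norm \<xi>)\<^sup>2) powr (r / 2)"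
  let ?D = "\<lambda>\<xi>. G \<xi> - H \<xi>"
  define M where "M \<xi> = G \<xi> - of_real (A \<xi>) * H \<xi>" for \<xi>
  have A: "0 < A \<xi>" "A \<xi> \<le> 1" for \<xi>
    using \<open>0 < \<tau>\<close> by (auto simp: A_def regularizing_filter_range less_imp_le)
  have [measurable]: "A \<in> borel_measurable borel"
    unfolding A_def by (rule regularizing_filter_measurable)
  have w_ge_1: "1 \<le> ?w q \<xi>" for \<xi>
    using \<open>0 < q\<close> by (intro ge_one_powr_ge_zero) auto
  have D: "?D \<in> L2" by (rule L2_minus(1)[OF G H])
  have A1: "\<bar>1 - A \<xi>\<bar> \<le> 1" for \<xi>
    using A[of \<xi>] by linarith
  have contraction: "(\<lambda>\<xi>. of_real (1 - A \<xi>) * F \<xi>) \<in> L2" "L2_norm (\<lambda>\<xi>. of_real (1 - A \<xi>) * F \<xi>) \<le> 1 * L2_norm F"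
    if F: "F \<in> L2" for F :: "real ^ 'n \<Rightarrow> complex"
  proof -
    have le: "AE \<xi> in lebesgue. \<bar>1 - A \<xi>\<bar> * cmod (F \<xi>) \<le> 1 * cmod (F \<xi>)"
      by (intro AE_I2 mult_right_mono A1) simp
    show "(\<lambda>\<xi>. of_real (1 - A \<xi>) * F \<xi>) \<in> L2" "L2_norm (\<lambda>\<xi>. of_real (1 - A \<xi>) * F \<xi>) \<le> 1 * L2_norm F"
      by (rule L2_multiplier_bound[OF _ F F zero_le_one le]; measurable)+
  qed
  note AD = contraction[OF D] and AH = contraction(1)[OF H]
  \<comment> \<open>In \<open>(1 - A) H = (1 - A) G - (1 - A) (G - H)\<close> the noise accounts for
    at most \<delta>. Since \<open>\<theta> > 1\<close>, the rest of the discrepancy must come from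
    the exact data, whose weighted norm is known.\<close>
  have residual: "(\<theta> - 1) * \<delta> \<le> c * N"
    if c: "0 \<le> c" "\<And>\<xi>. 1 - A \<xi> \<le> c * ?w q \<xi>" for c
  proof -
    have le: "AE \<xi> in lebesgue. \<bar>1 - A \<xi>\<bar> * cmod (G \<xi>) \<le> c * cmod (sobolev_weight q G \<xi>)"
    proof (rule AE_I2)
      fix \<xi>
      have "\<bar>1 - A \<xi>\<bar> * cmod (G \<xi>) \<le> (c * ?w q \<xi>) * cmod (G \<xi>)"
        using c(2)[of \<xi>] A[of \<xi>] by (intro mult_right_mono) auto
      then show "\<bar>1 - A \<xi>\<bar> * cmod (G \<xi>) \<le> c * cmod (sobolev_weight q G \<xi>)"
        by (simp add: sobolev_weight_def norm_mult mult.assoc)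
    qed
    have AG: "(\<lambda>\<xi>. of_real (1 - A \<xi>) * G \<xi>) \<in> L2"
      "L2_norm (\<lambda>\<xi>. of_real (1 - A \<xi>) * G \<xi>) \<le> c * L2_norm (sobolev_weight q G)"
      by (rule L2_multiplier_bound[OF _ G WG(1) c(1) le]; measurable)+
    have "\<theta> * \<delta> = L2_norm (\<lambda>\<xi>. of_real (1 - A \<xi>) * G \<xi> - of_real (1 - A \<xi>) * ?D \<xi>)"
      unfolding discrepancy[symmetric] by (simp add: right_diff_distrib)
    also have "\<dots> \<le> c * N + \<delta>"
      using L2_minus(2)[OF AG(1) AD(1)] AG(2) AD(2) GH mult_left_mono[OF WG(2) c(1)] by linarith
    finally show ?thesis by (simp add: algebra_simps)
  qed
  \<comment> \<open>The choice \<open>c = 1\<close> bounds \<delta> by \<open>N\<close> and takes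
    care of the summand \<open>1\<close> in the weighted filter bound. The choice
    \<open>c = (1 + \<tau>) * \<alpha> powr q\<close> below takes care of the summand with
    \<open>\<alpha> powr - q\<close>.\<close>
  have delta_le: "(\<theta> - 1) * \<delta> \<le> 1 * N"
  proof (rule residual)
    show "1 - A \<xi> \<le> 1 * ?w q \<xi>" for \<xi>
      using A[of \<xi>] w_ge_1[of \<xi>] by linarith
  qed simp
  have "(\<theta> - 1) * \<delta> \<le> ((1 + \<tau>) * \<alpha> powr q) * N"
    by (rule residual) (use assms in \<open>auto simp: A_def intro!: one_minus_regularizing_filter_le\<close>)
  then have "(\<theta> - 1) * \<delta> * \<alpha> powr - q \<le> ((1 + \<tau>) * \<alpha> powr q) * N * \<alpha> powr - q"
    by (intro mult_right_mono) auto
  also have "((1 + \<tau>) * \<alpha> powr q) * N * \<alpha> powr - q = (1 + \<tau>) * N * (\<alpha> powr q * \<alpha> powr - q)"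
    by (simp only: mult_ac)
  also have "\<alpha> powr q * \<alpha> powr - q = 1"
    using \<open>0 < \<alpha>\<close> by (simp flip: powr_add)
  finally have alpha_le: "(\<theta> - 1) * (\<alpha> powr - q * \<delta>) \<le> (1 + \<tau>) * N"
    by (simp add: mult_ac)
  have M: "M \<in> L2" "L2_norm M \<le> (1 + \<theta>) * \<delta>"
  proof -
    \<comment> \<open>Data error plus discrepancy: the origin of
      \<open>1 + \<theta>\<close>.\<close>
    have M_eq: "M = (\<lambda>\<xi>. ?D \<xi> + of_real (1 - A \<xi>) * H \<xi>)"
      by (auto simp: M_def algebra_simps)
    show "M \<in> L2" unfolding M_eq by (rule L2_add(1)[OF D AH])
    show "L2_norm M \<le> (1 + \<theta>) * \<delta>"
      unfolding M_eq using L2_add(2)[OF D AH] GH discrepancy by (simp add: algebra_simps)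
  qed
  define c where "c = 2 powr (q / 2) * (1 + (1 + 1 / \<tau>) * \<alpha> powr - q)"
  have "0 \<le> c" using \<open>0 < \<tau>\<close> by (simp add: c_def)
  have WM: "sobolev_weight q M \<in> L2" "L2_norm (sobolev_weight q M) \<le> K * N"
  proof -
    \<comment> \<open>The weighted norm calls for another splitting,
      \<open>M = (1 - A) G + A (G - H)\<close>: the weight falls on the smooth exact data, and the
      rough noise is damped by the filter.\<close>
    have M_eq: "sobolev_weight q M = (\<lambda>\<xi>. of_real (1 - A \<xi>) * sobolev_weight q G \<xi> + of_real (?w q \<xi> * A \<xi>) * ?D \<xi>)"
      by (auto simp: M_def sobolev_weight_def algebra_simps)
    note 1 = contraction[OF WG(1)]
    have le: "AE \<xi> in lebesgue. \<bar>?w q \<xi> * A \<xi>\<bar> * cmod (?D \<xi>) \<le> c * cmod (?D \<xi>)"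
      using sobolev_weight_regularizing_filter_le[OF \<open>0 < \<tau>\<close> less_imp_le[OF \<open>0 < q\<close>] \<open>q \<le> s\<close> \<open>0 < \<alpha>\<close>] A
      by (intro AE_I2 mult_right_mono) (auto simp: A_def c_def abs_mult less_imp_le)
    have 2: "(\<lambda>\<xi>. of_real (?w q \<xi> * A \<xi>) * ?D \<xi>) \<in> L2"
      "L2_norm (\<lambda>\<xi>. of_real (?w q \<xi> * A \<xi>) * ?D \<xi>) \<le> c * L2_norm ?D"
      by (rule L2_multiplier_bound[OF _ D D \<open>0 \<le> c\<close> le]; measurable)+
    show "sobolev_weight q M \<in> L2" unfolding M_eq by (rule L2_add(1)[OF 1(1) 2(1)])
    \<comment> \<open>In \<open>K\<close> the summand \<open>1\<close> belongs to the weighted exact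
      data; the quotient by \<open>\<theta> - 1\<close> collects \<open>delta_le\<close> and
      \<open>alpha_le\<close>.\<close>
    have "c * \<delta> = 2 powr (q / 2) * (\<delta> + (1 + 1 / \<tau>) * (\<alpha> powr - q * \<delta>))"
      by (simp add: c_def algebra_simps)
    also have "\<dots> \<le> 2 powr (q / 2) * (N / (\<theta> - 1) + (1 + 1 / \<tau>) * ((1 + \<tau>) * N / (\<theta> - 1)))"
      using delta_le alpha_le \<open>1 < \<theta>\<close> \<open>0 < \<tau>\<close>
      by (intro mult_left_mono add_mono) (auto simp: pos_le_divide_eq mult.commute)
    also have "N + \<dots> = K * N"
      using \<open>1 < \<theta>\<close> by (simp add: K_def add_divide_distrib distrib_left distrib_right)
    finally have "N + c * \<delta> \<le> K * N" by simp
    then show "L2_norm (sobolev_weight q M) \<le> K * N"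
      unfolding M_eq using L2_add(2)[OF 1(1) 2(1)] 1(2) 2(2) WG(2) mult_left_mono[OF GH \<open>0 \<le> c\<close>] by linarith
  qed
  have "0 \<le> K" using \<open>1 < \<theta>\<close> \<open>0 < \<tau>\<close> by (simp add: K_def)
  have "0 \<le> 1 + \<theta>" using \<open>1 < \<theta>\<close> by simp
  note est = sobolev_weight_interpolation[OF \<open>0 < q\<close> \<open>0 \<le> l\<close> \<open>l \<le> q\<close> \<open>0 < \<delta>\<close> \<open>0 < N\<close> \<open>0 \<le> 1 + \<theta>\<close> \<open>0 \<le> K\<close> M WM]
  show "sobolev_weight l (\<lambda>\<xi>. G \<xi> - of_real (A \<xi>) * H \<xi>) \<in> L2"
    "L2_norm (sobolev_weight l (\<lambda>\<xi>. G \<xi> - of_real (A \<xi>) * H \<xi>))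
      \<le> (1 + \<theta> + K) * N powr (l / q) * \<delta> powr (1 - l / q)"
    using est by (simp_all add: M_def[abs_def])
qed

section \<open>The error estimate\<close>

theorem theorem6:
  fixes \<gamma> T \<tau> s \<theta> p l :: real
  assumes "0 < \<gamma>" and "\<gamma> < 1" and "0 < T" and "0 < \<tau>" and "0 < s" and "1 < \<theta>"
    and "0 < p" and "p + 2 \<le> s"
    and "0 \<le> l" and "l \<le> p + 2" and "p + 2 - l \<le> s"
  shows "\<exists>C>0. \<forall>\<delta>>0. \<forall>E>0.
    \<forall>(u :: real \<Rightarrow> real ^ 'n \<Rightarrow> complex) g g\<delta> u\<delta> \<alpha>.
      final_value_solution \<gamma> T g u \<longrightarrow>
      u 0 \<in> sobolev_space p \<longrightarrow> sobolev_norm p (u 0) \<le> E \<longrightarrow>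
      g\<delta> \<in> L2 \<longrightarrow> L2_norm (\<lambda>x. g x - g\<delta> x) \<le> \<delta> \<longrightarrow>
      0 < \<theta> * \<delta> \<longrightarrow> \<theta> * \<delta> < L2_norm g\<delta> \<longrightarrow>
      0 < \<alpha> \<longrightarrow>
      L2_norm (\<lambda>\<xi>. of_real (1 - regularizing_filter \<tau> s \<alpha> \<xi>) * fourier g\<delta> \<xi>) = \<theta> * \<delta> \<longrightarrow>
      regularized_solution \<gamma> T \<tau> s \<alpha> g\<delta> u\<delta> \<longrightarrow>
      (\<forall>t\<in>{0<..T}.
         (\<lambda>x. u t x - u\<delta> t x) \<in> sobolev_space l \<and>
         sobolev_norm l (\<lambda>x. u t x - u\<delta> t x)
           \<le> C / t powr \<gamma> * E powr (l / (p + 2)) * \<delta> powr (1 - l / (p + 2)))"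
proof -
  define q where "q = p + 2"
  have q: "0 < q" "q \<le> s" "l \<le> q" using assms by (auto simp: q_def)
  note \<gamma> = \<open>0 < \<gamma>\<close> \<open>\<gamma> < 1\<close>
  obtain \<kappa> where "0 < \<kappa>" and ratio: "\<And>t (\<xi> :: real ^ 'n). 0 < t \<Longrightarrow> t \<le> T \<Longrightarrow>
      propagator \<gamma> t \<xi> / propagator \<gamma> T \<xi> \<le> \<kappa> / t powr \<gamma>"
    using propagator_ratio_bound[OF \<gamma> \<open>0 < T\<close>] by metis
  obtain B where "0 < B" and smoothing: "\<And>\<xi> :: real ^ 'n. (1 + (norm \<xi>)\<^sup>2) * propagator \<gamma> T \<xi> \<le> B"
    using propagator_smoothing[OF \<gamma> \<open>0 < T\<close>] by metis
  define K where "K = 1 + 2 powr (q / 2) * (1 + (1 + 1 / \<tau>) * (1 + \<tau>)) / (\<theta> - 1)"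
  have "0 < K" using assms by (simp add: K_def add_pos_nonneg)
  \<comment> \<open>\<open>\<kappa>\<close> bounds the quotient of propagators,
    \<open>1 + \<theta> + K\<close> is the constant of the discrepancy estimate, and
    \<open>B powr (l / q)\<close> arises because that estimate is applied with
    \<open>N = B * E\<close>.\<close>
  define C where "C = \<kappa> * (1 + \<theta> + K) * B powr (l / q)"
  have "0 < C" using assms \<open>0 < \<kappa>\<close> \<open>0 < B\<close> \<open>0 < K\<close> by (simp add: C_def)
  have main: "(\<lambda>x. u t x - u\<delta> t x) \<in> sobolev_space l \<and>
      sobolev_norm l (\<lambda>x. u t x - u\<delta> t x) \<le> C / t powr \<gamma> * E powr (l / q) * \<delta> powr (1 - l / q)"
    if "0 < \<delta>" "0 < E" and u: "final_value_solution \<gamma> T g u" "u 0 \<in> sobolev_space p" "sobolev_norm p (u 0) \<le> E"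
      and g\<delta>: "g\<delta> \<in> L2" "L2_norm (\<lambda>x. g x - g\<delta> x) \<le> \<delta>" and "0 < \<alpha>"
      and discrepancy: "L2_norm (\<lambda>\<xi>. of_real (1 - regularizing_filter \<tau> s \<alpha> \<xi>) * fourier g\<delta> \<xi>) = \<theta> * \<delta>"
      and u\<delta>: "regularized_solution \<gamma> T \<tau> s \<alpha> g\<delta> u\<delta>" and t: "0 < t" "t \<le> T"
    for \<delta> E \<alpha> t g g\<delta> u\<delta> and u :: "real \<Rightarrow> real ^ 'n \<Rightarrow> complex"
  proof -
    define A where "A = (regularizing_filter \<tau> s \<alpha> :: real ^ 'n \<Rightarrow> real)"
    define P where "P = (propagator \<gamma> :: real \<Rightarrow> real ^ 'n \<Rightarrow> real)"
    have P_pos: "0 < P t \<xi>" for t \<xi> unfolding P_def by (rule propagator_pos[OF \<gamma>])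
    define G where "G = fourier g"
    define H where "H = fourier g\<delta>"
    have g: "g \<in> L2" and uT_g: "AE x in lebesgue. u T x = g x"
      and u_L2: "\<And>t. t \<in> {0..T} \<Longrightarrow> u t \<in> L2"
      and u_freq: "\<And>t. t \<in> {0..T} \<Longrightarrow> AE \<xi> in lebesgue. fourier (u t) \<xi> = fourier (u 0) \<xi> * of_real (P t \<xi>)"
      using u(1) by (auto simp: final_value_solution_def diffusion_solution_def P_def)
    have "fourier (u T) = G"
      unfolding G_def using u_L2[of T] g uT_g \<open>0 < T\<close> by (intro fourier_cong_AE L2_measurable) auto
    with u_freq[of T] \<open>0 < T\<close> have G_freq: "AE \<xi> in lebesgue. G \<xi> = fourier (u 0) \<xi> * of_real (P T \<xi>)"
      by simp
    have G_L2: "G \<in> L2" and H_L2: "H \<in> L2"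
      unfolding G_def H_def using g g\<delta> by (auto intro: fourier_L2)
    have GH: "L2_norm (\<lambda>\<xi>. G \<xi> - H \<xi>) \<le> \<delta>"
    proof -
      have "AE \<xi> in lebesgue. cmod (G \<xi> - H \<xi>) \<le> 1 * cmod (fourier (\<lambda>x. g x - g\<delta> x) \<xi>)"
        using fourier_diff[OF g g\<delta>(1)] by eventually_elim (simp add: G_def H_def)
      then have "L2_norm (\<lambda>\<xi>. G \<xi> - H \<xi>) \<le> 1 * L2_norm (fourier (\<lambda>x. g x - g\<delta> x))"
        using g g\<delta> G_L2 H_L2
        by (intro L2_cmult_bound(2)[OF L2_measurable[OF L2_minus(1)] fourier_L2[OF L2_minus(1)]]) auto
      also have "\<dots> \<le> L2_norm (\<lambda>x. g x - g\<delta> x)"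
        using fourier_plancherel_le[OF L2_minus(1)[OF g g\<delta>(1)]] by simp
      finally show ?thesis using g\<delta>(2) by simp
    qed
    have W0: "sobolev_weight p (fourier (u 0)) \<in> L2" "L2_norm (sobolev_weight p (fourier (u 0))) \<le> E"
      using u(2,3) by (auto simp: sobolev_space_def sobolev_norm_def)
    \<comment> \<open>The weight of order \<open>q\<close> is the weight of order \<open>p\<close>
      times \<open>1 + (norm \<xi>)\<^sup>2\<close>, and the propagator at time \<open>T\<close>
      absorbs the latter factor.\<close>
    have WG_le: "AE \<xi> in lebesgue. \<bar>(1 + (norm \<xi>)\<^sup>2) powr (q / 2)\<bar> * cmod (G \<xi>) \<le> B * cmod (sobolev_weight p (fourier (u 0)) \<xi>)"
      using G_freq
    proof eventually_elim
      case (elim \<xi>)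
      have w: "0 < 1 + (norm \<xi>)\<^sup>2" by (simp add: add_pos_nonneg)
      have "(1 + (norm \<xi>)\<^sup>2) powr (q / 2) = (1 + (norm \<xi>)\<^sup>2) powr (p / 2) * (1 + (norm \<xi>)\<^sup>2)"
        using w by (simp add: q_def add_divide_distrib powr_add)
      then have "\<bar>(1 + (norm \<xi>)\<^sup>2) powr (q / 2)\<bar> * cmod (G \<xi>)
          = ((1 + (norm \<xi>)\<^sup>2) * P T \<xi>) * cmod (sobolev_weight p (fourier (u 0)) \<xi>)"
        using w P_pos[of T \<xi>] by (simp add: elim sobolev_weight_def norm_mult abs_mult)
      also have "\<dots> \<le> B * cmod (sobolev_weight p (fourier (u 0)) \<xi>)"
        unfolding P_def by (intro mult_right_mono smoothing) simp
      finally show ?case .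
    qed
    note WG_bound = L2_multiplier_bound[OF sobolev_weight_measurable G_L2 W0(1) less_imp_le[OF \<open>0 < B\<close>] WG_le]
    have WG: "sobolev_weight q G \<in> L2" "L2_norm (sobolev_weight q G) \<le> B * E"
      using WG_bound mult_left_mono[OF W0(2) less_imp_le[OF \<open>0 < B\<close>]]
      by (auto simp: sobolev_weight_def[abs_def])
    define M where "M \<xi> = G \<xi> - of_real (A \<xi>) * H \<xi>" for \<xi>
    have "0 < B * E" using \<open>0 < B\<close> \<open>0 < E\<close> by simp
    note WM = discrepancy_principle_estimate[OF \<open>0 < \<tau>\<close> q(1,2) \<open>0 \<le> l\<close> q(3) \<open>1 < \<theta>\<close> \<open>0 < \<delta>\<close> \<open>0 < B * E\<close> \<open>0 < \<alpha>\<close>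
        G_L2 H_L2 GH WG discrepancy[folded H_def], folded A_def K_def, folded M_def[abs_def]]
    define D where "D = fourier (\<lambda>x. u t x - u\<delta> t x)"
    have uu: "u t \<in> L2" "u\<delta> t \<in> L2"
      using u_L2 u\<delta> t by (auto simp: regularized_solution_def)
    then have diff_L2: "(\<lambda>x. u t x - u\<delta> t x) \<in> L2" by (rule L2_minus(1))
    then have D_L2: "D \<in> L2" unfolding D_def by (rule fourier_L2)
    have u\<delta>_freq: "AE \<xi> in lebesgue. fourier (u\<delta> t) \<xi> = of_real (P t \<xi> / P T \<xi> * A \<xi>) * H \<xi>"
      using u\<delta> t by (auto simp: regularized_solution_def P_def A_def H_def)
    have ut_freq: "AE \<xi> in lebesgue. fourier (u t) \<xi> = fourier (u 0) \<xi> * of_real (P t \<xi>)"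
      using t by (intro u_freq) simp
    \<comment> \<open>Dividing by the positive \<open>P T \<xi>\<close> expresses
      \<open>fourier (u 0)\<close> through \<open>G\<close>. The exact and the regularized solution
      then share the multiplier \<open>P t \<xi> / P T \<xi>\<close>.\<close>
    have D_freq: "AE \<xi> in lebesgue. D \<xi> = of_real (P t \<xi> / P T \<xi>) * M \<xi>"
      using fourier_diff[OF uu] u\<delta>_freq ut_freq G_freq
    proof eventually_elim
      case (elim \<xi>)
      then show ?case
        using P_pos[of T \<xi>] by (simp add: D_def M_def field_simps)
    qed
    have "0 < \<kappa> / t powr \<gamma>" using \<open>0 < \<kappa>\<close> t by simp
    \<comment> \<open>The multiplier is bounded uniformly in frequency and commutes with the weight,
      so the error at time \<open>t\<close> inherits the weighted estimate for
      \<open>M\<close>.\<close>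
    have WD_le: "AE \<xi> in lebesgue. \<bar>(1 + (norm \<xi>)\<^sup>2) powr (l / 2)\<bar> * cmod (D \<xi>) \<le> \<kappa> / t powr \<gamma> * cmod (sobolev_weight l M \<xi>)"
      using D_freq
    proof eventually_elim
      case (elim \<xi>)
      have "0 \<le> P t \<xi> / P T \<xi>" using P_pos by (simp add: less_imp_le)
      then have "\<bar>(1 + (norm \<xi>)\<^sup>2) powr (l / 2)\<bar> * cmod (D \<xi>) = P t \<xi> / P T \<xi> * cmod (sobolev_weight l M \<xi>)"
        unfolding elim using P_pos[of t \<xi>] P_pos[of T \<xi>]
        by (simp add: sobolev_weight_def norm_mult norm_divide)
      also have "\<dots> \<le> \<kappa> / t powr \<gamma> * cmod (sobolev_weight l M \<xi>)"
        unfolding P_def by (intro mult_right_mono ratio t) simp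
      finally show ?case .
    qed
    note WD_bound = L2_multiplier_bound[OF sobolev_weight_measurable D_L2 WM(1) less_imp_le[OF \<open>0 < \<kappa> / t powr \<gamma>\<close>] WD_le]
    have "sobolev_weight l D \<in> L2" "L2_norm (sobolev_weight l D) \<le> \<kappa> / t powr \<gamma> * L2_norm (sobolev_weight l M)"
      using WD_bound by (simp_all add: sobolev_weight_def[abs_def])
    note this(1)
    moreover have "L2_norm (sobolev_weight l D) \<le> C / t powr \<gamma> * E powr (l / q) * \<delta> powr (1 - l / q)"
    proof -
      have "L2_norm (sobolev_weight l D) \<le> \<kappa> / t powr \<gamma> * L2_norm (sobolev_weight l M)" by fact
      also have "\<dots> \<le> \<kappa> / t powr \<gamma> * ((1 + \<theta> + K) * (B * E) powr (l / q) * \<delta> powr (1 - l / q))"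
        using WM(2) \<open>0 < \<kappa> / t powr \<gamma>\<close> by (intro mult_left_mono) auto
      also have "(B * E) powr (l / q) = B powr (l / q) * E powr (l / q)"
        by (rule powr_mult)
      finally show ?thesis by (simp add: C_def mult_ac)
    qed
    ultimately show ?thesis
      using diff_L2 by (simp add: sobolev_space_def sobolev_norm_def D_def)
  qed
  show ?thesis
    unfolding q_def[symmetric]
    by (intro exI[of _ C] conjI \<open>0 < C\<close> allI impI ballI main) auto
qed

end
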